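(* Let $X$ be a connected topological manifold without boundary, and let $n\ge 1$. Then the inclusion map $i_n(X) : F_n(X)\hookrightarrow\prod_1^nX$ is $(\dim(X)-1)$-connected.
   Context: $F_n(X)=\{(x_1,\dots,x_n)\in\prod_1^nX\mid x_i\ne x_j\text{ for all }i\ne j\}$ is the $n$-th configuration space. A map $f:X\to Y$ of pointed spaces is $m$-connected if the induced homomorphism $\pi_j(f):\pi_j(X)\to\pi_j(Y)$ is surjective if $j=m$ and is an isomorphism for all $j\le m-1$. *)

theory Defs
  imports "HOL-Analysis.Analysis" "HOL-Algebra.Group"
begin

subsection \<open>Topological manifolds\<close>

definition second_countable_space :: "'a topology \<Rightarrow> bool"
  where "second_countable_space X \<longleftrightarrow>
    (\<exists>\<B>. countable \<B> \<and> (\<forall>V\<in>\<B>. openin X V) \<and>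
         (\<forall>U x. openin X U \<and> x \<in> U \<longrightarrow> (\<exists>V\<in>\<B>. x \<in> V \<and> V \<subseteq> U)))"

text \<open>Charts take values in open subsets of Euclidean space (not of a half-space), so there is no
  boundary.\<close>

definition topological_manifold :: "nat \<Rightarrow> 'a topology \<Rightarrow> bool"
  where "topological_manifold d X \<longleftrightarrow>
    Hausdorff_space X \<and> second_countable_space X \<and>
    (\<forall>x \<in> topspace X. \<exists>U V. openin X U \<and> x \<in> U \<and> openin (Euclidean_space d) V \<and>
       subtopology X U homeomorphic_space subtopology (Euclidean_space d) V)"

subsection \<open>Configuration spaces\<close>

abbreviation power_space :: "nat \<Rightarrow> 'a topology \<Rightarrow> (nat \<Rightarrow> 'a) topology"
  where "power_space n X \<equiv> product_topology (\<lambda>_. X) {1..n}"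

definition configuration_space :: "nat \<Rightarrow> 'a topology \<Rightarrow> (nat \<Rightarrow> 'a) topology"
  where "configuration_space n X =
    subtopology (power_space n X)
      {x. \<forall>i\<in>{1..n}. \<forall>j\<in>{1..n}. i \<noteq> j \<longrightarrow> x i \<noteq> x j}"

subsection \<open>Homotopy groups\<close>

text \<open>As in \<^const>\<open>Euclidean_space\<close>, points of the \<open>j\<close>-cube are sequences vanishing from
  index \<open>j\<close> on. The 0-cube is a single point and has empty boundary.\<close>

definition cube :: "nat \<Rightarrow> (nat \<Rightarrow> real) set"
  where "cube j = {t. (\<forall>i<j. 0 \<le> t i \<and> t i \<le> 1) \<and> (\<forall>i\<ge>j. t i = 0)}"

definition cube_boundary :: "nat \<Rightarrow> (nat \<Rightarrow> real) set"
  where "cube_boundary j = {t \<in> cube j. \<exists>i<j. t i = 0 \<or> t i = 1}"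

definition cube_topology :: "nat \<Rightarrow> (nat \<Rightarrow> real) topology"
  where "cube_topology j = subtopology (Euclidean_space j) (cube j)"

definition cube_maps :: "nat \<Rightarrow> 'a topology \<Rightarrow> 'a \<Rightarrow> ((nat \<Rightarrow> real) \<Rightarrow> 'a) set"
  where "cube_maps j X x0 =
    {f. continuous_map (cube_topology j) X f \<and> f ` cube_boundary j \<subseteq> {x0}}"

definition cube_homotopic ::
    "nat \<Rightarrow> 'a topology \<Rightarrow> 'a \<Rightarrow> ((nat \<Rightarrow> real) \<Rightarrow> 'a) \<Rightarrow> ((nat \<Rightarrow> real) \<Rightarrow> 'a) \<Rightarrow> bool"
  where "cube_homotopic j X x0 =
    homotopic_with (\<lambda>h. h ` cube_boundary j \<subseteq> {x0}) (cube_topology j) X"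

definition cube_class :: "nat \<Rightarrow> 'a topology \<Rightarrow> 'a \<Rightarrow> ((nat \<Rightarrow> real) \<Rightarrow> 'a) \<Rightarrow> ((nat \<Rightarrow> real) \<Rightarrow> 'a) set"
  where "cube_class j X x0 f = {g. cube_homotopic j X x0 f g}"

definition cube_concat ::
    "((nat \<Rightarrow> real) \<Rightarrow> 'a) \<Rightarrow> ((nat \<Rightarrow> real) \<Rightarrow> 'a) \<Rightarrow> (nat \<Rightarrow> real) \<Rightarrow> 'a"
  where "cube_concat f g =
    (\<lambda>t. if t 0 \<le> 1/2 then f (t(0 := 2 * t 0)) else g (t(0 := 2 * t 0 - 1)))"

text \<open>For \<open>j = 0\<close> the carrier is the set of path components (all of them, since the boundary
  condition is void), \<open>one\<close> is its base point, and \<open>mult\<close> is meaningless.\<close>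

definition homotopy_group ::
    "nat \<Rightarrow> 'a topology \<Rightarrow> 'a \<Rightarrow> ((nat \<Rightarrow> real) \<Rightarrow> 'a) set monoid"
  where "homotopy_group j X x0 =
    \<lparr>carrier = cube_class j X x0 ` cube_maps j X x0,
     mult = (\<lambda>A B. \<Union>f\<in>A. \<Union>g\<in>B. cube_class j X x0 (cube_concat f g)),
     one = cube_class j X x0 (\<lambda>_. x0)\<rparr>"

definition homotopy_group_map ::
    "nat \<Rightarrow> 'b topology \<Rightarrow> 'b \<Rightarrow> ('a \<Rightarrow> 'b) \<Rightarrow> ((nat \<Rightarrow> real) \<Rightarrow> 'a) set \<Rightarrow> ((nat \<Rightarrow> real) \<Rightarrow> 'b) set"
  where "homotopy_group_map j Y y0 \<phi> A = (\<Union>f\<in>A. cube_class j Y y0 (\<phi> \<circ> f))"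

text \<open>The degree \<open>m\<close> is an integer, so that \<open>m = -1\<close> imposes no condition. On \<open>\<pi>\<^sub>0\<close>,
  which is only a pointed set, an isomorphism is a bijection (base points are preserved because
  \<open>\<phi>\<close> is pointed).\<close>

definition m_connected_map ::
    "int \<Rightarrow> 'a topology \<Rightarrow> 'a \<Rightarrow> 'b topology \<Rightarrow> 'b \<Rightarrow> ('a \<Rightarrow> 'b) \<Rightarrow> bool"
  where "m_connected_map m X x0 Y y0 \<phi> \<longleftrightarrow>
    x0 \<in> topspace X \<and> continuous_map X Y \<phi> \<and> \<phi> x0 = y0 \<and>
    (\<forall>j. int j = m \<longrightarrow>
       homotopy_group_map j Y y0 \<phi> ` carrier (homotopy_group j X x0)
         = carrier (homotopy_group j Y y0)) \<and>
    (\<forall>j. int j \<le> m - 1 \<longrightarrow>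
       (if j = 0
        then bij_betw (homotopy_group_map j Y y0 \<phi>)
               (carrier (homotopy_group j X x0)) (carrier (homotopy_group j Y y0))
        else homotopy_group_map j Y y0 \<phi> \<in> iso (homotopy_group j X x0) (homotopy_group j Y y0)))"

subsection \<open>Well-definedness on homotopy classes\<close>

lemma topspace_cube_topology [simp]: "topspace (cube_topology j) = cube j"
  by (auto simp: cube_topology_def topspace_Euclidean_space cube_def)

lemma cube_homotopic_refl_iff: "cube_homotopic j X x0 f f \<longleftrightarrow> f \<in> cube_maps j X x0"
  by (simp add: cube_homotopic_def cube_maps_def)

lemma cube_homotopic_sym: "cube_homotopic j X x0 f g \<Longrightarrow> cube_homotopic j X x0 g f"
  unfolding cube_homotopic_def by (rule homotopic_with_symD)

lemma cube_homotopic_trans: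
  "cube_homotopic j X x0 f g \<Longrightarrow> cube_homotopic j X x0 g h \<Longrightarrow> cube_homotopic j X x0 f h"
  unfolding cube_homotopic_def by (rule homotopic_with_trans)

lemma cube_class_eqI: "cube_homotopic j X x0 f g \<Longrightarrow> cube_class j X x0 f = cube_class j X x0 g"
  unfolding cube_class_def
  by (rule Collect_cong, rule iffI)
    (erule cube_homotopic_trans[OF cube_homotopic_sym], assumption, erule (1) cube_homotopic_trans)

lemma cube_homotopic_compose:
  assumes "cube_homotopic j X x0 f g" "continuous_map X Y \<phi>" "\<phi> x0 = y0"
  shows "cube_homotopic j Y y0 (\<phi> \<circ> f) (\<phi> \<circ> g)"
  unfolding cube_homotopic_def
proof (rule homotopic_with_compose_continuous_map_left[OF assms(1)[unfolded cube_homotopic_def] assms(2)])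
  show "(\<phi> \<circ> h) ` cube_boundary j \<subseteq> {y0}" if "h ` cube_boundary j \<subseteq> {x0}" for h
    using that assms(3) by auto
qed

lemma homotopy_group_map_cube_class:
  assumes "continuous_map X Y \<phi>" "\<phi> x0 = y0" "f \<in> cube_maps j X x0"
  shows "homotopy_group_map j Y y0 \<phi> (cube_class j X x0 f) = cube_class j Y y0 (\<phi> \<circ> f)"
proof -
  have "cube_class j Y y0 (\<phi> \<circ> g) = cube_class j Y y0 (\<phi> \<circ> f)" if "g \<in> cube_class j X x0 f" for g
    using that assms cube_class_eqI cube_homotopic_compose
    unfolding cube_class_def mem_Collect_eq by metis
  moreover have "f \<in> cube_class j X x0 f"
    using assms by (simp add: cube_class_def cube_homotopic_refl_iff)
  ultimately show ?thesis
    unfolding homotopy_group_map_def by blast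
qed

lemma cube_topology_eq: "cube_topology j = top_of_set (cube j)"
proof -
  have "{x. \<forall>i\<ge>j. x i = 0} \<inter> cube j = cube j"
    by (auto simp: cube_def)
  then have "cube_topology j = subtopology (powertop_real UNIV) (cube j)"
    by (simp only: cube_topology_def Euclidean_space_def subtopology_subtopology)
  also have "powertop_real UNIV = (euclidean :: (nat \<Rightarrow> real) topology)"
    by (rule euclidean_product_topology)
  finally show ?thesis .
qed

lemma cube_homotopic_concat:
  assumes "j > 0" "cube_homotopic j X x0 f f'" "cube_homotopic j X x0 g g'"
  shows "cube_homotopic j X x0 (cube_concat f g) (cube_concat f' g')"
proof -
  let ?I = "top_of_set {0..1::real}"
  obtain h where h: "continuous_map (prod_topology ?I (cube_topology j)) X h"
      "\<And>t. h (0, t) = f t" "\<And>t. h (1, t) = f' t"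
      "\<And>s t. s \<in> {0..1} \<Longrightarrow> t \<in> cube_boundary j \<Longrightarrow> h (s, t) = x0"
    using assms(2) unfolding cube_homotopic_def homotopic_with_def by (auto simp: image_subset_iff)
  obtain k where k: "continuous_map (prod_topology ?I (cube_topology j)) X k"
      "\<And>t. k (0, t) = g t" "\<And>t. k (1, t) = g' t"
      "\<And>s t. s \<in> {0..1} \<Longrightarrow> t \<in> cube_boundary j \<Longrightarrow> k (s, t) = x0"
    using assms(3) unfolding cube_homotopic_def homotopic_with_def by (auto simp: image_subset_iff)
  define L where "L = (\<lambda>t::nat\<Rightarrow>real. t(0 := 2 * t 0))"
  define R where "R = (\<lambda>t::nat\<Rightarrow>real. t(0 := 2 * t 0 - 1))"
  have L: "L t \<in> cube j" if "t \<in> cube j" "t 0 \<le> 1/2" for t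
    using that \<open>j > 0\<close> by (auto simp: L_def cube_def)
  have R: "R t \<in> cube j" if "t \<in> cube j" "1/2 \<le> t 0" for t
    using that \<open>j > 0\<close> by (auto simp: R_def cube_def)
  have upd: "continuous_on S (\<lambda>p. (snd p)(0 := c * snd p 0 + d))"
    for S :: "(real \<times> (nat \<Rightarrow> real)) set" and c d
  proof (rule continuous_on_coordinatewise_then_product)
    fix i
    have snd: "continuous_on S (\<lambda>p. snd p i)" for i :: nat
      by (rule continuous_on_product_then_coordinatewise) (rule continuous_on_snd[OF continuous_on_id])
    then have "continuous_on S (\<lambda>p. c * snd p 0 + d)"
      by (intro continuous_on_add continuous_on_mult continuous_on_const)
    with snd[of i] show "continuous_on S (\<lambda>p. ((snd p)(0 := c * snd p 0 + d)) i)"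
      by (cases "i = 0") simp_all
  qed
  have prodeq: "prod_topology ?I (cube_topology j) = top_of_set ({0..1::real} \<times> cube j)"
    by (simp add: cube_topology_eq)
  have subeq: "subtopology (top_of_set ({0..1::real} \<times> cube j))
      {p \<in> topspace (top_of_set ({0..1::real} \<times> cube j)). Q p}
      = top_of_set {p \<in> {0..1::real} \<times> cube j. Q p}" for Q
    unfolding subtopology_subtopology by (rule arg_cong[where f = top_of_set]) auto
  define H where "H = (\<lambda>p. if snd p 0 \<le> (1/2::real) then h (fst p, L (snd p)) else k (fst p, R (snd p)))"
  have "continuous_map (top_of_set ({0..1::real} \<times> cube j)) X H"
    unfolding H_def
  proof (rule continuous_map_cases_le)
    have "continuous_on UNIV (\<lambda>p::real \<times> (nat \<Rightarrow> real). snd p 0)"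
      by (rule continuous_on_product_then_coordinatewise) (intro continuous_intros)
    then show "continuous_map (top_of_set ({0..1::real} \<times> cube j)) euclideanreal (\<lambda>p. snd p 0)"
      using continuous_on_subset[OF _ subset_UNIV] by simp
    show "continuous_map (top_of_set ({0..1::real} \<times> cube j)) euclideanreal (\<lambda>p. 1/2)"
      by simp
    have "continuous_map (top_of_set {p \<in> {0..1::real} \<times> cube j. snd p 0 \<le> 1/2})
        (top_of_set ({0..1::real} \<times> cube j)) (\<lambda>p. (fst p, L (snd p)))"
      using L upd[of _ 2 0]
      by (auto simp: L_def intro!: continuous_on_Pair continuous_on_fst continuous_on_id)
    from continuous_map_compose[OF this h(1)[unfolded prodeq]]
    show "continuous_map (subtopology (top_of_set ({0..1::real} \<times> cube j))
        {p \<in> topspace (top_of_set ({0..1::real} \<times> cube j)). snd p 0 \<le> 1/2}) X (\<lambda>p. h (fst p, L (snd p)))"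
      by (simp only: o_def subeq)
    have "continuous_map (top_of_set {p \<in> {0..1::real} \<times> cube j. 1/2 \<le> snd p 0})
        (top_of_set ({0..1::real} \<times> cube j)) (\<lambda>p. (fst p, R (snd p)))"
      using R upd[of _ 2 "-1"]
      by (auto simp: R_def intro!: continuous_on_Pair continuous_on_fst continuous_on_id)
    from continuous_map_compose[OF this k(1)[unfolded prodeq]]
    show "continuous_map (subtopology (top_of_set ({0..1::real} \<times> cube j))
        {p \<in> topspace (top_of_set ({0..1::real} \<times> cube j)). 1/2 \<le> snd p 0}) X (\<lambda>p. k (fst p, R (snd p)))"
      by (simp only: o_def subeq)
    fix p :: "real \<times> (nat \<Rightarrow> real)"
    assume p: "p \<in> topspace (top_of_set ({0..1::real} \<times> cube j))" "snd p 0 = 1/2"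
    then have "L (snd p) \<in> cube_boundary j" "R (snd p) \<in> cube_boundary j"
      using \<open>j > 0\<close> by (auto simp: L_def R_def cube_boundary_def cube_def)
    then show "h (fst p, L (snd p)) = k (fst p, R (snd p))"
      using p h(4) k(4) by auto
  qed
  moreover have "H (s, t) = x0" if st: "s \<in> {0..1}" "t \<in> cube_boundary j" for s t
  proof -
    obtain i where i: "i < j" "t i = 0 \<or> t i = 1" "t \<in> cube j"
      using st(2) by (auto simp: cube_boundary_def)
    show ?thesis
    proof (cases "t 0 \<le> 1/2")
      case True
      then have "L t \<in> cube_boundary j"
        using i L[of t] unfolding cube_boundary_def L_def
        by (cases "i = 0") (auto intro!: exI[of _ i])
      then show ?thesis using True h(4) st(1) by (simp add: H_def)
    next
      case False
      then have "R t \<in> cube_boundary j"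
        using i R[of t] unfolding cube_boundary_def R_def
        by (cases "i = 0") (auto intro!: exI[of _ i])
      then show ?thesis using False k(4) st(1) by (simp add: H_def)
    qed
  qed
  ultimately show ?thesis
    unfolding cube_homotopic_def homotopic_with_def prodeq
    by (intro exI[of _ H]) (simp add: image_subset_iff H_def cube_concat_def L_def R_def h(2,3) k(2,3))
qed

lemma homotopy_group_mult_cube_class:
  assumes "j > 0" "f \<in> cube_maps j X x0" "g \<in> cube_maps j X x0"
  shows "cube_class j X x0 f \<otimes>\<^bsub>homotopy_group j X x0\<^esub> cube_class j X x0 g
    = cube_class j X x0 (cube_concat f g)"
proof -
  have "cube_class j X x0 (cube_concat f' g') = cube_class j X x0 (cube_concat f g)"
    if "f' \<in> cube_class j X x0 f" "g' \<in> cube_class j X x0 g" for f' g'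
    using that cube_class_eqI[OF cube_homotopic_concat[OF \<open>j > 0\<close>]]
    unfolding cube_class_def mem_Collect_eq by metis
  moreover have "f \<in> cube_class j X x0 f" "g \<in> cube_class j X x0 g"
    using assms by (simp_all add: cube_class_def cube_homotopic_refl_iff)
  ultimately show ?thesis
    unfolding homotopy_group_def monoid.simps by blast
qed

end

theory Submission
  imports Defs
begin

text \<open>A map \<open>f = (f\<^sub>1, \<dots>, f\<^sub>n)\<close> from the \<open>k\<close>-cube to \<open>X\<^sup>n\<close> misses \<open>F\<^sub>n(X)\<close> exactly where two of its
  components agree, and agreement of two points of a \<open>d\<close>-manifold is, in a chart, a system of \<open>d\<close>
  equations. If \<open>k < d\<close>, general position should therefore remove all the coincidences by an
  arbitrarily small homotopy, supported away from the places where there are none. This gives the key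
  fact \<open>deform_into_configuration_space\<close>: a map of the \<open>k\<close>-cube into \<open>X\<^sup>n\<close> that sends the boundary into
  \<open>F\<^sub>n(X)\<close> is homotopic, relative to the boundary, to a map into \<open>F\<^sub>n(X)\<close>. For \<open>k = j < d\<close> it gives
  surjectivity on \<open>\<pi>\<^sub>j\<close>; applied to a homotopy, which is a map of the cube of dimension
  \<open>k = j + 1 < d\<close>, it gives injectivity on \<open>\<pi>\<^sub>j\<close>.

  A topological manifold offers no smooth or piecewise linear approximation, so general position is
  obtained locally. The Euclidean core is \<open>avoid_map_below_dimension\<close>: given a map \<open>q\<close> from a compact
  part of the \<open>k\<close>-cube to \<open>\<real>\<^sup>d\<close>, there is a map \<open>u\<close> to \<open>[-1, 1]\<^sup>d\<close> that nowhere coincides with \<open>q\<close>.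
  One takes \<open>u = q - p + c\<close>, with \<open>p\<close> a Lipschitz approximation to \<open>q\<close> and \<open>c\<close> a small vector that is not
  a value of \<open>p\<close>; such a \<open>c\<close> exists because a Lipschitz map does not raise dimension, which here is
  a pigeonhole argument on two grids.

  To pass from local to global, the only property used of a diagonal \<open>D \<subseteq> X\<^sup>n\<close> is that points near it
  can be moved in \<open>d\<close> independent directions, at most one displacement \<open>q(y)\<close> of each point \<open>y\<close> landing
  in \<open>D\<close> (\<open>displaceable\<close>). Moving \<open>f(t)\<close> by a small multiple of \<open>u(t) \<noteq> q(f(t))\<close>, cut off by a bump
  function, clears a ball of the cube (\<open>displace_near_point\<close>), and finitely many balls cover all the
  coincidences. What has been achieved by earlier moves is an open condition on the graph of the map,
  and each move may be chosen so small that the graph stays in a prescribed neighbourhood.\<close>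

section \<open>Maps into Euclidean spaces of larger dimension\<close>

text \<open>A Lipschitz map cannot raise dimension. Divide the \<open>k\<close>-cube into about \<open>N\<^sup>k\<close> cells and consider
  \<open>M\<^sup>d\<close> lattice points with spacing \<open>1/M\<close> in the target, where \<open>N = C M\<close> and \<open>C\<close> depends only on \<open>L\<close> and
  \<open>k\<close>. The image of a cell is too small to contain two lattice points, and as \<open>k < d\<close>
  there are fewer cells than lattice points once \<open>M\<close> is large.\<close>

lemma lipschitz_map_misses_point:
  fixes p :: "(nat \<Rightarrow> real) \<Rightarrow> nat \<Rightarrow> real"
  assumes "k < d" "K \<subseteq> cube k" "L \<ge> 0"
    and lip: "\<And>s t i. s \<in> K \<Longrightarrow> t \<in> K \<Longrightarrow> i < d \<Longrightarrow> \<bar>p s i - p t i\<bar> \<le> L * (\<Sum>l<k. \<bar>s l - t l\<bar>)"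
  obtains c :: "nat \<Rightarrow> real"
  where "\<And>i. i < d \<Longrightarrow> \<bar>c i\<bar> \<le> 1/2" "\<And>t. t \<in> K \<Longrightarrow> \<exists>i<d. p t i \<noteq> c i"
proof -
  obtain C0 :: nat where C0: "L * real k < real C0"
    using reals_Archimedean2 by blast
  \<comment> \<open>\<open>M > (2C)\<^sup>k\<close> ensures \<open>(N + 1)\<^sup>k \<le> (2CM)\<^sup>k < M\<^sup>k\<^sup>+\<^sup>1\<close>.\<close>
  define C M N where "C = Suc C0" and "M = (2 * C) ^ k + 1" and "N = C * M"
  have C: "L * real k < real C" "C > 0" and M: "M > 0" and N: "N > 0"
    using C0 by (auto simp: C_def M_def N_def)
  define B where "B = {..<d} \<rightarrow>\<^sub>E {..<M}"
  define c where "c = (\<lambda>(b::nat \<Rightarrow> nat) i. real (b i) / real M - 1/2)"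
  define cell where "cell = (\<lambda>t::nat \<Rightarrow> real. restrict (\<lambda>l. nat \<lfloor>real N * t l\<rfloor>) {..<k})"
  have c: "\<bar>c b i\<bar> \<le> 1/2" if "b \<in> B" "i < d" for b i
  proof -
    have "b i < M" using that by (auto simp: B_def)
    then have "real (b i) / real M \<le> 1" "real (b i) / real M \<ge> 0" using M by auto
    then show ?thesis unfolding c_def by linarith
  qed
  have "\<exists>b\<in>B. \<forall>t\<in>K. \<exists>i<d. p t i \<noteq> c b i"
  proof (rule ccontr)
    assume "\<not> ?thesis"
    then have "\<forall>b\<in>B. \<exists>t\<in>K. \<forall>i<d. p t i = c b i" by blast
    then obtain \<tau> where \<tau>: "\<And>b. b \<in> B \<Longrightarrow> \<tau> b \<in> K" "\<And>b i. b \<in> B \<Longrightarrow> i < d \<Longrightarrow> p (\<tau> b) i = c b i"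
      by metis
    have unit: "0 \<le> \<tau> b l" "\<tau> b l \<le> 1" if "b \<in> B" "l < k" for b l
      using \<tau>(1)[OF that(1)] assms(2) that(2) by (auto simp: cube_def)
    have "inj_on (cell \<circ> \<tau>) B"
    proof (rule inj_onI)
      fix b b' assume b: "b \<in> B" "b' \<in> B" and eq: "(cell \<circ> \<tau>) b = (cell \<circ> \<tau>) b'"
      have near: "\<bar>\<tau> b l - \<tau> b' l\<bar> \<le> 1 / real N" if "l < k" for l
      proof -
        have "nat \<lfloor>real N * \<tau> b l\<rfloor> = nat \<lfloor>real N * \<tau> b' l\<rfloor>"
          using fun_cong[OF eq, of l] that by (simp add: cell_def)
        moreover have "0 \<le> real N * \<tau> b l" "0 \<le> real N * \<tau> b' l" using unit b that by simp_all
        ultimately have "\<lfloor>real N * \<tau> b l\<rfloor> = \<lfloor>real N * \<tau> b' l\<rfloor>"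
          by (metis eq_nat_nat_iff zero_le_floor)
        then have "\<bar>real N * \<tau> b l - real N * \<tau> b' l\<bar> \<le> 1" by linarith
        then have "real N * \<bar>\<tau> b l - \<tau> b' l\<bar> \<le> 1"
          by (simp add: abs_mult flip: right_diff_distrib)
        then show ?thesis using N by (simp add: field_simps)
      qed
      have "b i = b' i" if "i < d" for i
      proof -
        have "\<bar>c b i - c b' i\<bar> \<le> L * (\<Sum>l<k. \<bar>\<tau> b l - \<tau> b' l\<bar>)"
          using lip[of "\<tau> b" "\<tau> b'" i] \<tau> b that by simp
        also have "\<dots> \<le> L * (\<Sum>l<k. 1 / real N)"
          by (intro mult_left_mono sum_mono near \<open>L \<ge> 0\<close>) simp
        also have "\<dots> = (L * real k) / real N" by simp
        also have "\<dots> < real C / real N" using C N by (simp add: divide_strict_right_mono)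
        also have "\<dots> = 1 / real M" using C M by (simp add: N_def)
        finally have "\<bar>real (b i) - real (b' i)\<bar> / real M < 1 / real M"
          by (simp add: c_def flip: diff_divide_distrib)
        then have "\<bar>real (b i) - real (b' i)\<bar> < 1" using M by (simp add: divide_less_cancel)
        then show ?thesis by linarith
      qed
      then show "b = b'" using b unfolding B_def by (intro PiE_ext) auto
    qed
    moreover have "(cell \<circ> \<tau>) ` B \<subseteq> {..<k} \<rightarrow>\<^sub>E {..N}"
    proof -
      have "nat \<lfloor>real N * \<tau> b l\<rfloor> \<le> N" if "b \<in> B" "l < k" for b l
        using mult_left_mono[OF unit(2)[OF that], of "real N"] by linarith
      then have "cell (\<tau> b) \<in> {..<k} \<rightarrow>\<^sub>E {..N}" if "b \<in> B" for b
        using that unfolding cell_def by (intro restrict_PiE_iff[THEN iffD2]) auto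
      then show ?thesis by auto
    qed
    moreover have "finite ({..<k} \<rightarrow>\<^sub>E {..N})" by (simp add: finite_PiE)
    ultimately have "card B \<le> card ({..<k} \<rightarrow>\<^sub>E {..N})"
      by (metis card_inj_on_le)
    then have "M ^ d \<le> (N + 1) ^ k" by (simp add: B_def card_PiE)
    also have "\<dots> \<le> (2 * C * M) ^ k"
      using N by (intro power_mono) (simp_all add: N_def)
    also have "\<dots> = (2 * C) ^ k * M ^ k" by (rule power_mult_distrib)
    also have "\<dots> < M * M ^ k" using M by (simp add: M_def)
    also have "\<dots> = M ^ Suc k" by simp
    also have "\<dots> \<le> M ^ d" using \<open>k < d\<close> M by (intro power_increasing) auto
    finally show False by simp
  qed
  then show ?thesis using that c by blast
qed

lemma lipschitz_imp_continuous_on: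
  fixes g :: "(nat \<Rightarrow> real) \<Rightarrow> real"
  assumes "\<And>s t. s \<in> K \<Longrightarrow> t \<in> K \<Longrightarrow> \<bar>g s - g t\<bar> \<le> L * (\<Sum>l<k. \<bar>s l - t l\<bar>)"
  shows "continuous_on K g"
  unfolding continuous_on_def
proof
  fix s assume s: "s \<in> K"
  have "continuous_on K (\<lambda>t. L * (\<Sum>l<k. \<bar>t l - s l\<bar>))"
    by (intro continuous_intros continuous_on_product_then_coordinatewise[OF continuous_on_id])
  then have "((\<lambda>t. L * (\<Sum>l<k. \<bar>t l - s l\<bar>)) \<longlongrightarrow> 0) (at s within K)"
    using s by (auto simp: continuous_on_def)
  moreover have "\<forall>\<^sub>F t in at s within K. norm (g t - g s) \<le> L * (\<Sum>l<k. \<bar>t l - s l\<bar>)"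
    unfolding eventually_at_filter by (rule always_eventually) (use assms s in auto)
  ultimately have "((\<lambda>t. g t - g s) \<longlongrightarrow> 0) (at s within K)"
    by (rule Lim_null_comparison[rotated])
  then show "(g \<longlongrightarrow> g s) (at s within K)" by (simp add: LIM_zero_iff)
qed

text \<open>The Lipschitz functions on a compact set form an algebra that separates points, so the
  Stone-Weierstrass theorem applies to them.\<close>

lemma lipschitz_approximation:
  fixes f :: "(nat \<Rightarrow> real) \<Rightarrow> real"
  assumes "compact K" "K \<subseteq> cube k" "continuous_on K f" "e > 0"
  obtains g L where "L \<ge> 0" "\<And>s t. s \<in> K \<Longrightarrow> t \<in> K \<Longrightarrow> \<bar>g s - g t\<bar> \<le> L * (\<Sum>l<k. \<bar>s l - t l\<bar>)"
    "\<And>t. t \<in> K \<Longrightarrow> \<bar>f t - g t\<bar> < e"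
proof -
  define \<rho> where "\<rho> = (\<lambda>s t :: nat \<Rightarrow> real. \<Sum>l<k. \<bar>s l - t l\<bar>)"
  define R where "R = {g. \<exists>L\<ge>0. \<forall>s\<in>K. \<forall>t\<in>K. \<bar>g s - g t\<bar> \<le> L * \<rho> s t}"
  have \<rho>: "\<rho> s t \<ge> 0" for s t by (simp add: \<rho>_def sum_nonneg)
  have cont: "continuous_on K g" if "g \<in> R" for g
    using that lipschitz_imp_continuous_on[of K g _ k] unfolding R_def \<rho>_def by blast
  interpret function_ring_on R K
  proof
    fix g h assume g: "g \<in> R" and h: "h \<in> R"
    obtain L where L: "L \<ge> 0" "\<And>s t. s \<in> K \<Longrightarrow> t \<in> K \<Longrightarrow> \<bar>g s - g t\<bar> \<le> L * \<rho> s t"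
      using g by (auto simp: R_def)
    obtain L' where L': "L' \<ge> 0" "\<And>s t. s \<in> K \<Longrightarrow> t \<in> K \<Longrightarrow> \<bar>h s - h t\<bar> \<le> L' * \<rho> s t"
      using h by (auto simp: R_def)
    have "\<bar>(g s + h s) - (g t + h t)\<bar> \<le> (L + L') * \<rho> s t" if "s \<in> K" "t \<in> K" for s t
      using L(2)[OF that] L'(2)[OF that] by (simp add: algebra_simps)
    then show "(\<lambda>x. g x + h x) \<in> R"
      unfolding R_def mem_Collect_eq using L(1) L'(1) by (intro exI[of _ "L + L'"]) auto
    obtain B where B: "B \<ge> 0" "\<And>t. t \<in> K \<Longrightarrow> \<bar>g t\<bar> \<le> B"
      using compact_imp_bounded[OF compact_continuous_image[OF cont[OF g] \<open>compact K\<close>]]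
      unfolding bounded_pos by (auto intro: less_imp_le)
    obtain B' where B': "B' \<ge> 0" "\<And>t. t \<in> K \<Longrightarrow> \<bar>h t\<bar> \<le> B'"
      using compact_imp_bounded[OF compact_continuous_image[OF cont[OF h] \<open>compact K\<close>]]
      unfolding bounded_pos by (auto intro: less_imp_le)
    have "\<bar>g s * h s - g t * h t\<bar> \<le> (B * L' + B' * L) * \<rho> s t" if "s \<in> K" "t \<in> K" for s t
    proof -
      have "g s * h s - g t * h t = g s * (h s - h t) + h t * (g s - g t)" by (simp add: algebra_simps)
      then have "\<bar>g s * h s - g t * h t\<bar> \<le> \<bar>g s\<bar> * \<bar>h s - h t\<bar> + \<bar>h t\<bar> * \<bar>g s - g t\<bar>"
        by (metis abs_mult abs_triangle_ineq)
      also have "\<dots> \<le> B * (L' * \<rho> s t) + B' * (L * \<rho> s t)"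
        using B B' L L' that by (intro add_mono mult_mono) auto
      finally show ?thesis by (simp add: algebra_simps)
    qed
    then show "(\<lambda>x. g x * h x) \<in> R"
      unfolding R_def mem_Collect_eq using L(1) L'(1) B(1) B'(1)
      by (intro exI[of _ "B * L' + B' * L"]) auto
  next
    show "(\<lambda>_. c) \<in> R" for c by (auto simp: R_def \<rho>)
  next
    fix s t assume st: "s \<in> K" "t \<in> K" "s \<noteq> t"
    then obtain l where l: "s l \<noteq> t l" by blast
    have "s l = t l" if "l \<ge> k" using subsetD[OF assms(2) st(1)] subsetD[OF assms(2) st(2)] that
      by (simp add: cube_def)
    then have "l < k" using l by (meson not_le)
    then have "\<bar>a l - b l\<bar> \<le> 1 * \<rho> a b" for a b
      using member_le_sum[of l "{..<k}" "\<lambda>l. \<bar>a l - b l\<bar>"] by (simp add: \<rho>_def)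
    then have "(\<lambda>a. a l) \<in> R" unfolding R_def by (auto intro!: exI[of _ "1::real"])
    then show "\<exists>g\<in>R. g s \<noteq> g t" using l by (intro bexI[of _ "\<lambda>a. a l"])
  qed (use cont \<open>compact K\<close> in auto)
  obtain g where "g \<in> R" "\<And>t. t \<in> K \<Longrightarrow> \<bar>f t - g t\<bar> < e"
    using Stone_Weierstrass_basic[OF assms(3,4)] by blast
  then show ?thesis using that[of _ g] unfolding R_def \<rho>_def by blast
qed

text \<open>The space \<open>[-1, 1]\<^sup>d\<close> of displacements; as for \<^const>\<open>cube\<close>, its points are sequences vanishing
  from index \<open>d\<close> on.\<close>

definition centred_cube :: "nat \<Rightarrow> (nat \<Rightarrow> real) set"
  where "centred_cube d = {v. (\<forall>i<d. \<bar>v i\<bar> \<le> 1) \<and> (\<forall>i\<ge>d. v i = 0)}"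

lemma compact_PiE_UNIV:
  fixes S :: "nat \<Rightarrow> real set"
  assumes "\<And>i. compact (S i)"
  shows "compact (PiE UNIV S)"
  using compactin_PiE[of "\<lambda>_. euclideanreal" UNIV S] assms
  by (simp add: euclidean_product_topology)

lemma compact_cube: "compact (cube k)"
proof -
  have "t \<in> cube k \<longleftrightarrow> (\<forall>i. t i \<in> (if i < k then {0..1} else {0}))" for t
    unfolding cube_def mem_Collect_eq by (simp add: if_distrib[of "\<lambda>S. _ \<in> S"]) (meson not_le)
  then have "cube k = PiE UNIV (\<lambda>i. if i < k then {0..1} else {0})"
    by (auto simp: PiE_iff)
  moreover have "compact (PiE UNIV (\<lambda>i. if i < k then {0..1::real} else {0}))"
    by (rule compact_PiE_UNIV) simp
  ultimately show ?thesis by simp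
qed

lemma compact_centred_cube: "compact (centred_cube d)"
proof -
  have "t \<in> centred_cube d \<longleftrightarrow> (\<forall>i. t i \<in> (if i < d then {-1..1} else {0}))" for t
    unfolding centred_cube_def mem_Collect_eq
    by (simp add: if_distrib[of "\<lambda>S. _ \<in> S"] abs_le_iff minus_le_iff) (meson not_le)
  then have "centred_cube d = PiE UNIV (\<lambda>i. if i < d then {-1..1} else {0})"
    by (auto simp: PiE_iff)
  moreover have "compact (PiE UNIV (\<lambda>i. if i < d then {-1..1::real} else {0}))"
    by (rule compact_PiE_UNIV) simp
  ultimately show ?thesis by simp
qed

text \<open>For \<open>k = d\<close> this fails by Brouwer's fixed point theorem: if \<open>q\<close> is a homeomorphism onto the target
  cube, then every \<open>u\<close> coincides with it somewhere. Applied to \<open>q / \<delta>\<close>, the lemma gives a map \<open>\<delta> u\<close> that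
  nowhere coincides with \<open>q\<close> and is as small as desired.\<close>

lemma avoid_map_below_dimension:
  fixes q :: "(nat \<Rightarrow> real) \<Rightarrow> nat \<Rightarrow> real"
  assumes "k < d" "compact K" "K \<subseteq> cube k" and q: "continuous_on K q"
  obtains u where "continuous_on K u" "u ` K \<subseteq> centred_cube d" "\<And>t. t \<in> K \<Longrightarrow> u t \<noteq> q t"
proof -
  have qi: "continuous_on K (\<lambda>t. q t i)" for i
    by (rule continuous_on_product_then_coordinatewise[OF q])
  define P where "P = (\<lambda>i g L. L \<ge> 0 \<and> (\<forall>s\<in>K. \<forall>t\<in>K. \<bar>g s - g t\<bar> \<le> L * (\<Sum>l<k. \<bar>s l - t l\<bar>)) \<and>
      (\<forall>t\<in>K. \<bar>q t i - g t\<bar> < (1/2 :: real)))"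
  have "\<exists>g L. P i g L" for i
    unfolding P_def by (rule lipschitz_approximation[OF assms(2,3) qi[of i], of "1/2"]) (simp, blast)
  then obtain g L where gL: "\<And>i. P i (g i) (L i)"
    by metis
  have L: "\<And>i. L i \<ge> 0"
      "\<And>i s t. s \<in> K \<Longrightarrow> t \<in> K \<Longrightarrow> \<bar>g i s - g i t\<bar> \<le> L i * (\<Sum>l<k. \<bar>s l - t l\<bar>)"
    and near: "\<And>i t. t \<in> K \<Longrightarrow> \<bar>q t i - g i t\<bar> < 1/2"
    using gL unfolding P_def by blast+
  have lip: "\<bar>g i s - g i t\<bar> \<le> (\<Sum>i<d. L i) * (\<Sum>l<k. \<bar>s l - t l\<bar>)"
    if "s \<in> K" "t \<in> K" "i < d" for i s t
  proof -
    have "L i \<le> (\<Sum>i<d. L i)" using \<open>i < d\<close> L(1) by (intro member_le_sum) auto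
    then have "L i * (\<Sum>l<k. \<bar>s l - t l\<bar>) \<le> (\<Sum>i<d. L i) * (\<Sum>l<k. \<bar>s l - t l\<bar>)"
      by (intro mult_right_mono sum_nonneg) auto
    with L(2)[OF that(1,2), of i] show ?thesis by (rule order_trans)
  qed
  have "(\<Sum>i<d. L i) \<ge> 0" using L(1) by (simp add: sum_nonneg)
  from lipschitz_map_misses_point[OF assms(1,3) this, where p = "\<lambda>t i. g i t", OF lip]
  obtain c where c: "\<And>i. i < d \<Longrightarrow> \<bar>c i\<bar> \<le> 1/2" "\<And>t. t \<in> K \<Longrightarrow> \<exists>i<d. g i t \<noteq> c i"
    by blast
  have gcont: "continuous_on K (g i)" for i
    by (rule lipschitz_imp_continuous_on[OF L(2)[of _ _ i]])
  \<comment> \<open>\<open>u t = q t\<close> would mean \<open>g t = c\<close>.\<close>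
  define u where "u = (\<lambda>t i. if i < d then q t i - g i t + c i else 0)"
  show ?thesis
  proof (rule that[of u])
    show "continuous_on K u"
    proof (rule continuous_on_coordinatewise_then_product)
      show "continuous_on K (\<lambda>t. u t i)" for i
        unfolding u_def using qi gcont by (cases "i < d") (auto intro!: continuous_intros)
    qed
    show "u ` K \<subseteq> centred_cube d"
    proof (clarsimp simp: centred_cube_def u_def)
      fix t i assume "t \<in> K" "i < d"
      then show "\<bar>q t i - g i t + c i\<bar> \<le> 1" using near[of t i] c(1)[of i] by linarith
    qed
    show "u t \<noteq> q t" if "t \<in> K" for t
    proof -
      obtain i where "i < d" "g i t \<noteq> c i" using c(2) \<open>t \<in> K\<close> by blast
      then have "u t i \<noteq> q t i" by (simp add: u_def)
      then show ?thesis by auto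
    qed
  qed
qed

section \<open>Displacing maps off a subset\<close>

text \<open>\<open>M (y, v)\<close> is the point \<open>y\<close> moved by \<open>v\<close>; it may leave \<open>U\<close>. The last condition expresses that \<open>D\<close> has
  codimension at least \<open>d\<close>: think of \<open>D\<close> as \<open>{y. q y = 0}\<close> and of the motion as lowering \<open>q\<close> by \<open>v\<close>.\<close>

definition displacement ::
    "nat \<Rightarrow> 'b topology \<Rightarrow> 'b set \<Rightarrow> 'b set \<Rightarrow> ('b \<times> (nat \<Rightarrow> real) \<Rightarrow> 'b) \<Rightarrow> ('b \<Rightarrow> nat \<Rightarrow> real) \<Rightarrow> bool"
  where "displacement d Z D U M q \<longleftrightarrow>
    openin Z U \<and>
    continuous_map (prod_topology (subtopology Z U) (top_of_set (centred_cube d))) Z M \<and>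
    continuous_map (subtopology Z U) euclidean q \<and>
    (\<forall>y\<in>U. M (y, \<lambda>_. 0) = y) \<and>
    (\<forall>y\<in>U. \<forall>v\<in>centred_cube d. M (y, v) \<in> D \<longrightarrow> v = q y)"

definition displaceable :: "nat \<Rightarrow> 'b topology \<Rightarrow> 'b set \<Rightarrow> bool"
  where "displaceable d Z D \<longleftrightarrow> (\<forall>z \<in> topspace Z \<inter> D. \<exists>U M q. displacement d Z D U M q \<and> z \<in> U)"

lemma interval_tube:
  assumes "compact_space C" "openin (prod_topology C (top_of_set {0..1::real})) W"
    and "\<And>c. c \<in> topspace C \<Longrightarrow> (c, 0) \<in> W"
  obtains \<delta> where "0 < \<delta>" "\<delta> \<le> 1" "\<And>c s. c \<in> topspace C \<Longrightarrow> 0 \<le> s \<Longrightarrow> s \<le> \<delta> \<Longrightarrow> (c, s) \<in> W"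
proof -
  have "\<exists>U V. openin C U \<and> openin (top_of_set {0..1::real}) V \<and> topspace C \<subseteq> U \<and> 0 \<in> V \<and> U \<times> V \<subseteq> W"
    by (rule tube_lemma_left) (use assms in \<open>auto simp: compact_space_def\<close>)
  then obtain U V where UV: "openin (top_of_set {0..1::real}) V" "topspace C \<subseteq> U" "0 \<in> V" "U \<times> V \<subseteq> W"
    by blast
  then obtain e where e: "e > 0" "cball 0 e \<inter> {0..1} \<subseteq> V"
    by (auto simp: openin_contains_cball)
  show ?thesis
  proof (rule that[of "min e 1"])
    fix c s assume "c \<in> topspace C" "0 \<le> s" "s \<le> min e 1"
    moreover from this have "s \<in> V" using e(2) by (intro subsetD[OF e(2)]) auto
    ultimately show "(c, s) \<in> W" using UV by blast
  qed (use e in auto)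
qed

lemma scale_in_centred_cube:
  assumes "v \<in> centred_cube d" "0 \<le> s" "s \<le> 1"
  shows "(\<lambda>i. s * v i) \<in> centred_cube d"
  using assms by (auto simp: centred_cube_def abs_mult intro!: mult_le_one)

lemma continuous_on_scaled:
  fixes v :: "'b::topological_space \<Rightarrow> nat \<Rightarrow> real"
  assumes "continuous_on S a" "continuous_on S v"
  shows "continuous_on S (\<lambda>x i. a x * v x i)"
  by (rule continuous_on_coordinatewise_then_product)
    (intro continuous_on_mult assms(1) continuous_on_product_then_coordinatewise[OF assms(2)])

text \<open>The local move. The given motion is applied to \<open>f t\<close> with displacement \<open>\<delta> \<phi>(t) u(t)\<close>, where \<open>\<phi>\<close> is a bump
  function that is 1 on the ball of radius \<open>e\<close> and 0 off the ball of radius \<open>2 e\<close>, where \<open>\<delta>\<close> is so small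
  that the graph remains in \<open>W\<close>, and where \<open>u\<close> avoids \<open>q (f t) / \<delta>\<close>. The homotopy is constant on \<open>A\<close>; its
  restriction there is called \<open>f0\<close> so that moves starting from different maps can be concatenated.\<close>

lemma displace_near_point:
  assumes "k < d" and f: "continuous_map (cube_topology k) Z f"
    and W: "openin (prod_topology (cube_topology k) Z) W" "\<And>t. t \<in> cube k \<Longrightarrow> (t, f t) \<in> W"
    and A: "A \<subseteq> cube k" "\<And>t. t \<in> A \<Longrightarrow> f t = f0 t"
    and "e > 0" and far: "cball c (2 * e) \<inter> A = {}"
    and disp: "displacement d Z D U M q" and fU: "f ` (cube k \<inter> cball c (2 * e)) \<subseteq> U"
  obtains g where "homotopic_with (\<lambda>h. \<forall>t\<in>A. h t = f0 t) (cube_topology k) Z f g"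
    "\<And>t. t \<in> cube k \<Longrightarrow> (t, g t) \<in> W"
    "\<And>t. t \<in> cube k \<inter> cball c e \<Longrightarrow> g t \<notin> D"
proof -
  have M: "continuous_map (prod_topology (subtopology Z U) (top_of_set (centred_cube d))) Z M"
      "\<And>y. y \<in> U \<Longrightarrow> M (y, \<lambda>_. 0) = y"
    and q: "continuous_map (subtopology Z U) euclidean q"
      "\<And>y v. y \<in> U \<Longrightarrow> v \<in> centred_cube d \<Longrightarrow> M (y, v) \<in> D \<Longrightarrow> v = q y"
    using disp unfolding displacement_def by blast+
  define K where "K = cube k \<inter> cball c (2 * e)"
  let ?I = "top_of_set {0..1::real}" and ?T = "top_of_set (cube k)" and ?K = "top_of_set K"
  let ?B = "top_of_set (centred_cube d)"
  have K: "compact K" "K \<subseteq> cube k"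
    by (auto simp: K_def compact_cube intro!: compact_Int_closed)
  have fT: "continuous_map ?T Z f" using f by (simp add: cube_topology_eq)
  have fK: "continuous_map ?K (subtopology Z U) f"
    using continuous_map_from_subtopology_mono[OF fT K(2)] fU
    by (auto simp: continuous_map_in_subtopology K_def)
  have fU: "f t \<in> U" if "t \<in> K" for t using that fU by (auto simp: K_def)
  define \<Theta> where "\<Theta> = (\<lambda>((t, v), s). M (f t, \<lambda>i. s * (v :: nat \<Rightarrow> real) i))"
  let ?P = "prod_topology (prod_topology ?K ?B) ?I"
  have \<Theta>: "continuous_map ?P Z \<Theta>"
  proof -
    have "continuous_map ?P (prod_topology (subtopology Z U) ?B) (\<lambda>x. (f (fst (fst x)), \<lambda>i. snd x * snd (fst x) i))"
    proof (rule continuous_map_pairedI)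
      show "continuous_map ?P (subtopology Z U) (\<lambda>x. f (fst (fst x)))"
        by (rule continuous_map_compose[OF continuous_map_compose[OF continuous_map_fst continuous_map_fst] fK,
              unfolded o_def])
      have "continuous_on ((K \<times> centred_cube d) \<times> {0..1}) (\<lambda>x i. snd x * snd (fst x) i)"
        by (intro continuous_on_scaled continuous_on_fst continuous_on_snd continuous_on_id)
      moreover have "(\<lambda>i. snd x * snd (fst x) i) \<in> centred_cube d" if "x \<in> (K \<times> centred_cube d) \<times> {0..1}" for x
        using that by (intro scale_in_centred_cube) auto
      ultimately show "continuous_map ?P ?B (\<lambda>x i. snd x * snd (fst x) i)"
        by auto
    qed
    from continuous_map_compose[OF this M(1)] show ?thesis
      by (simp add: \<Theta>_def o_def case_prod_unfold)
  qed
  \<comment> \<open>All small displacements of the graph over \<open>K\<close> stay in \<open>W\<close>, by the tube lemma.\<close>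
  define W' where "W' = {x \<in> topspace ?P. (fst (fst x), \<Theta> x) \<in> W}"
  have "continuous_map ?P (prod_topology ?T Z) (\<lambda>x. (fst (fst x), \<Theta> x))"
  proof (rule continuous_map_pairedI[OF _ \<Theta>])
    have "continuous_on ((K \<times> centred_cube d) \<times> {0..1::real}) (\<lambda>x. fst (fst x))"
      by (intro continuous_intros)
    then show "continuous_map ?P ?T (\<lambda>x. fst (fst x))"
      using K(2) by auto
  qed
  then have W': "openin ?P W'"
    unfolding W'_def using W(1) by (intro openin_continuous_map_preimage) (auto simp: cube_topology_eq)
  have "compact_space (prod_topology ?K ?B)"
    using K compact_centred_cube by (simp add: compact_Times compact_space_subtopology)
  moreover have "(x, 0) \<in> W'" if "x \<in> topspace (prod_topology ?K ?B)" for x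
    using that W(2) K(2) by (auto simp: W'_def \<Theta>_def M(2) fU)
  ultimately obtain \<delta> where \<delta>: "0 < \<delta>" "\<delta> \<le> 1"
      "\<And>x s. x \<in> topspace (prod_topology ?K ?B) \<Longrightarrow> 0 \<le> s \<Longrightarrow> s \<le> \<delta> \<Longrightarrow> (x, s) \<in> W'"
    using interval_tube[OF _ W'] by metis
  have "continuous_on K (\<lambda>t. q (f t))"
    using continuous_map_compose[OF fK q(1)] by (simp add: o_def)
  then have "continuous_on K (\<lambda>t i. 1 / \<delta> * q (f t) i)"
    by (intro continuous_on_scaled continuous_on_const)
  from avoid_map_below_dimension[OF \<open>k < d\<close> K this]
  obtain u where u: "continuous_on K u" "u ` K \<subseteq> centred_cube d" "\<And>t. t \<in> K \<Longrightarrow> u t \<noteq> (\<lambda>i. 1 / \<delta> * q (f t) i)"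
    by blast
  define \<phi> where "\<phi> = (\<lambda>t. max 0 (min 1 (2 - dist c t / e)))"
  have \<phi>: "0 \<le> \<phi> t" "\<phi> t \<le> 1" for t by (auto simp: \<phi>_def)
  define r where "r = (\<lambda>s t. s * (\<delta> * \<phi> t))"
  have r: "0 \<le> r s t" "r s t \<le> \<delta>" "r s t \<le> 1" if "s \<in> {0..1}" for s t
  proof -
    have "\<delta> * \<phi> t \<le> \<delta>" "0 \<le> \<delta> * \<phi> t" using \<phi>[of t] \<delta>(1) by (auto simp: mult_left_le)
    moreover have "r s t \<le> 1 * (\<delta> * \<phi> t)"
      unfolding r_def using that \<phi>[of t] \<delta>(1) by (intro mult_right_mono) auto
    ultimately show "0 \<le> r s t" "r s t \<le> \<delta>" "r s t \<le> 1" using that \<delta>(2) by (auto simp: r_def)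
  qed
  define H where "H = (\<lambda>x. if dist c (snd x) \<le> 2 * e then M (f (snd x), \<lambda>i. r (fst x) (snd x) * u (snd x) i)
      else f (snd x))"
  have prodeq: "prod_topology ?I ?T = top_of_set ({0..1::real} \<times> cube k)" by simp
  have cdist: "continuous_on S (\<lambda>x. dist c (snd x))" for S :: "(real \<times> (nat \<Rightarrow> real)) set"
    by (intro continuous_on_dist continuous_on_const continuous_on_snd continuous_on_id)
  have H: "continuous_map (prod_topology ?I ?T) Z H"
    unfolding H_def prodeq
  proof (rule continuous_map_cases_le)
    show "continuous_map (top_of_set ({0..1::real} \<times> cube k)) euclideanreal (\<lambda>x. dist c (snd x))"
      using cdist by simp
    show "continuous_map (top_of_set ({0..1::real} \<times> cube k)) euclideanreal (\<lambda>x. 2 * e)"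
      by simp
    have eq: "subtopology (top_of_set ({0..1::real} \<times> cube k))
        {x \<in> topspace (top_of_set ({0..1::real} \<times> cube k)). dist c (snd x) \<le> 2 * e} = top_of_set ({0..1} \<times> K)"
      unfolding subtopology_subtopology by (rule arg_cong[where f = top_of_set]) (auto simp: K_def)
    have "continuous_map (prod_topology ?I ?K) (prod_topology (subtopology Z U) ?B)
       (\<lambda>x. (f (snd x), \<lambda>i. r (fst x) (snd x) * u (snd x) i))"
    proof (rule continuous_map_pairedI)
      show "continuous_map (prod_topology ?I ?K) (subtopology Z U) (\<lambda>x. f (snd x))"
        by (intro continuous_map_compose[OF _ fK, unfolded o_def] continuous_map_snd)
      have "continuous_on ({0..1} \<times> K) (\<lambda>x. u (snd x))"
        by (rule continuous_on_compose2[OF u(1) continuous_on_snd[OF continuous_on_id]]) auto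
      then have "continuous_on ({0..1} \<times> K) (\<lambda>x i. r (fst x) (snd x) * u (snd x) i)"
        unfolding r_def \<phi>_def using \<open>e > 0\<close>
        by (intro continuous_on_scaled continuous_on_mult continuous_on_max continuous_on_min continuous_on_diff
            continuous_on_divide cdist continuous_on_fst continuous_on_const continuous_on_id) auto
      moreover have "(\<lambda>i. r (fst x) (snd x) * u (snd x) i) \<in> centred_cube d" if "x \<in> {0..1} \<times> K" for x
        using that u(2) r by (intro scale_in_centred_cube) auto
      ultimately show "continuous_map (prod_topology ?I ?K) ?B (\<lambda>x i. r (fst x) (snd x) * u (snd x) i)"
        by auto
    qed
    from continuous_map_compose[OF this M(1)]
    show "continuous_map (subtopology (top_of_set ({0..1::real} \<times> cube k))
        {x \<in> topspace (top_of_set ({0..1::real} \<times> cube k)). dist c (snd x) \<le> 2 * e}) Z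
        (\<lambda>x. M (f (snd x), \<lambda>i. r (fst x) (snd x) * u (snd x) i))"
      unfolding eq by (simp add: o_def)
    have "continuous_map (prod_topology ?I ?T) Z (\<lambda>x. f (snd x))"
      by (intro continuous_map_compose[OF _ fT, unfolded o_def] continuous_map_snd)
    then show "continuous_map (subtopology (top_of_set ({0..1::real} \<times> cube k))
        {x \<in> topspace (top_of_set ({0..1::real} \<times> cube k)). 2 * e \<le> dist c (snd x)}) Z (\<lambda>x. f (snd x))"
      unfolding prodeq by (rule continuous_map_from_subtopology)
    fix x :: "real \<times> (nat \<Rightarrow> real)"
    assume x: "x \<in> topspace (top_of_set ({0..1::real} \<times> cube k))" "dist c (snd x) = 2 * e"
    then have "r (fst x) (snd x) = 0" using \<open>e > 0\<close> by (simp add: r_def \<phi>_def)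
    moreover have "snd x \<in> K" using x by (auto simp: K_def)
    ultimately show "M (f (snd x), \<lambda>i. r (fst x) (snd x) * u (snd x) i) = f (snd x)"
      by (simp add: M(2) fU)
  qed
  have HW: "(t, H (s, t)) \<in> W" if "t \<in> cube k" "s \<in> {0..1}" for s t
  proof (cases "dist c t \<le> 2 * e")
    case True
    then have "t \<in> K" using that by (auto simp: K_def)
    then have "((t, u t), r s t) \<in> W'"
      using u(2) r[OF that(2)] by (intro \<delta>(3)) auto
    then show ?thesis using True by (simp add: W'_def \<Theta>_def H_def)
  qed (use W(2) that in \<open>simp add: H_def\<close>)
  have "homotopic_with (\<lambda>h. \<forall>t\<in>A. h t = f0 t) (cube_topology k) Z f (\<lambda>t. H (1, t))"
  proof (subst homotopic_with)
    show "\<exists>h. continuous_map (prod_topology ?I (cube_topology k)) Z h \<and>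
       (\<forall>x\<in>topspace (cube_topology k). h (0, x) = f x) \<and>
       (\<forall>x\<in>topspace (cube_topology k). h (1, x) = H (1, x)) \<and> (\<forall>t\<in>{0..1}. \<forall>ta\<in>A. h (t, ta) = f0 ta)"
    proof (intro exI[of _ H] conjI ballI)
      show "continuous_map (prod_topology ?I (cube_topology k)) Z H"
        using H by (simp only: cube_topology_eq)
      show "H (0, t) = f t" if "t \<in> topspace (cube_topology k)" for t
        using that M(2)[OF fU, of t] by (auto simp: H_def r_def K_def)
      show "H (s, t) = f0 t" if "t \<in> A" for s t
        using that far A(2) by (auto simp: H_def)
    qed simp
  next
    show "(\<forall>t\<in>A. h t = f0 t) \<longleftrightarrow> (\<forall>t\<in>A. h' t = f0 t)"
      if "\<And>t. t \<in> topspace (cube_topology k) \<Longrightarrow> h t = h' t" for h h'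
    proof -
      have "h t = h' t" if "t \<in> A" for t using that A(1) \<open>\<And>t. _ \<Longrightarrow> h t = h' t\<close> by auto
      then show ?thesis by auto
    qed
  qed
  moreover have "H (1, t) \<notin> D" if "t \<in> cube k \<inter> cball c e" for t
  proof
    assume D: "H (1, t) \<in> D"
    have t: "t \<in> K" "dist c t \<le> e" using that \<open>e > 0\<close> by (auto simp: K_def)
    then have "\<phi> t = 1" using \<open>e > 0\<close> by (auto simp: \<phi>_def max_def min_def field_simps)
    then have "M (f t, \<lambda>i. \<delta> * u t i) \<in> D"
      using D t \<open>e > 0\<close> by (simp add: H_def r_def)
    moreover have "(\<lambda>i. \<delta> * u t i) \<in> centred_cube d"
      using u(2) t \<delta> by (intro scale_in_centred_cube) auto
    ultimately have "(\<lambda>i. \<delta> * u t i) = q (f t)" using q(2) fU t(1) by blast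
    then have "u t = (\<lambda>i. 1 / \<delta> * q (f t) i)" using \<delta>(1) by (auto simp: fun_eq_iff field_simps)
    then show False using u(3) t(1) by blast
  qed
  ultimately show ?thesis using that[of "\<lambda>t. H (1, t)"] HW by simp
qed

text \<open>Graphs of maps that send a closed set \<open>S\<close> into an open set \<open>V\<close> are those contained in this open set.\<close>

lemma openin_fst_imp_snd:
  assumes "closedin T S" "openin Z V"
  shows "openin (prod_topology T Z) {x \<in> topspace (prod_topology T Z). fst x \<in> S \<longrightarrow> snd x \<in> V}"
proof -
  have "closedin (prod_topology T Z) (S \<times> (topspace Z - V))"
    using assms by (simp add: closedin_prod_Times_iff closedin_diff)
  then have "openin (prod_topology T Z) (topspace (prod_topology T Z) - S \<times> (topspace Z - V))"
    by blast
  moreover have "topspace (prod_topology T Z) - S \<times> (topspace Z - V) =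
      {x \<in> topspace (prod_topology T Z). fst x \<in> S \<longrightarrow> snd x \<in> V}"
    by auto
  ultimately show ?thesis by simp
qed

text \<open>The points sent into \<open>D\<close> form a compact set, covered by finitely many balls to which the local move
  applies. The balls are cleared one after the other. Three open conditions on the graph are kept: no
  point outside the balls enters \<open>D\<close>, each doubled ball is still sent into the domain of its motion, and
  the balls already cleared remain so.\<close>

lemma displace_off:
  assumes "k < d" and D: "displaceable d Z D" "closedin Z D"
    and f: "continuous_map (cube_topology k) Z f"
    and W: "openin (prod_topology (cube_topology k) Z) W" "\<And>t. t \<in> cube k \<Longrightarrow> (t, f t) \<in> W"
    and A: "closed A" "A \<subseteq> cube k" "\<And>t. t \<in> A \<Longrightarrow> f t = f0 t" "\<And>t. t \<in> A \<Longrightarrow> f t \<notin> D"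
  obtains g where "homotopic_with (\<lambda>h. \<forall>t\<in>A. h t = f0 t) (cube_topology k) Z f g"
    "\<And>t. t \<in> cube k \<Longrightarrow> (t, g t) \<in> W" "\<And>t. t \<in> cube k \<Longrightarrow> g t \<notin> D"
proof -
  let ?T = "cube_topology k" and ?P = "\<lambda>h. \<forall>t\<in>A. h t = f0 t"
  define bad where "bad = {t \<in> cube k. f t \<in> D}"
  have fZ: "f t \<in> topspace Z" if "t \<in> cube k" for t
    using f that by (auto simp: continuous_map_def)
  have "closedin ?T bad"
    using closedin_continuous_map_preimage[OF f D(2)] by (simp add: bad_def)
  then have "compact bad"
    using closedin_compact compact_cube by (metis cube_topology_eq)
  have "\<exists>e U M q. e > 0 \<and> displacement d Z D U M q \<and> cball c (2 * e) \<inter> A = {} \<and> f ` (cube k \<inter> cball c (2 * e)) \<subseteq> U"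
    if c: "c \<in> bad" for c
  proof -
    have "f c \<in> topspace Z \<inter> D" using c fZ by (auto simp: bad_def)
    then obtain U M q where U: "displacement d Z D U M q" "f c \<in> U"
      using D(1) unfolding displaceable_def by blast
    have "openin ?T {t \<in> topspace ?T. f t \<in> U}"
      using U by (intro openin_continuous_map_preimage[OF f]) (simp add: displacement_def)
    then have "openin (top_of_set (cube k)) {t \<in> cube k. f t \<in> U}"
      by (simp add: cube_topology_eq)
    then obtain r where r: "r > 0" "cball c r \<inter> cube k \<subseteq> {t \<in> cube k. f t \<in> U}"
      using c U(2) by (auto simp: openin_contains_cball bad_def)
    have "c \<in> - A" using c A(4) by (auto simp: bad_def)
    moreover have "open (- A)" using A(1) by (simp add: open_Compl)
    ultimately obtain r' where r': "r' > 0" "cball c r' \<subseteq> - A"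
      by (auto simp: open_contains_cball)
    have "cball c (2 * (min r r' / 2)) \<subseteq> cball c r" "cball c (2 * (min r r' / 2)) \<subseteq> cball c r'"
      by (auto simp: subset_cball)
    then show ?thesis
      using U(1) r r' by (intro exI[of _ "min r r' / 2"] exI[of _ U] exI[of _ M] exI[of _ q]) auto
  qed
  then obtain e U M q where eU: "\<And>c. c \<in> bad \<Longrightarrow> e c > 0"
      "\<And>c. c \<in> bad \<Longrightarrow> displacement d Z D (U c) (M c) (q c)"
      "\<And>c. c \<in> bad \<Longrightarrow> cball c (2 * e c) \<inter> A = {}"
      "\<And>c. c \<in> bad \<Longrightarrow> f ` (cube k \<inter> cball c (2 * e c)) \<subseteq> U c"
    by metis
  have "bad \<subseteq> (\<Union>c\<in>bad. ball c (e c))" using eU(1) by auto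
  from compactE_image[OF \<open>compact bad\<close> _ this]
  obtain C where C: "C \<subseteq> bad" "finite C" "bad \<subseteq> (\<Union>c\<in>C. ball c (e c))"
    by auto
  have clo: "closedin ?T (cube k \<inter> S)" if "closed S" for S
    using that unfolding cube_topology_eq by (metis closedin_closed)
  let ?G = "\<lambda>S V. {x \<in> topspace (prod_topology ?T Z). fst x \<in> cube k \<inter> S \<longrightarrow> snd x \<in> V}"
  define far where "far = - (\<Union>c\<in>C. ball c (e c))"
  define W0 where "W0 = W \<inter> ?G far (topspace Z - D) \<inter>
      ((\<Inter>c\<in>C. ?G (cball c (2 * e c)) (U c)) \<inter> topspace (prod_topology ?T Z))"
  have "closed far" unfolding far_def by (intro closed_Compl open_UN) auto
  have W0: "openin (prod_topology ?T Z) W0"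
    unfolding W0_def
  proof (rule openin_Int[OF openin_Int[OF W(1)] openin_INT])
    show "openin (prod_topology ?T Z) (?G far (topspace Z - D))"
      using D(2) \<open>closed far\<close> by (intro openin_fst_imp_snd clo) auto
    show "openin (prod_topology ?T Z) (?G (cball c (2 * e c)) (U c))" if "c \<in> C" for c
      using eU(2) C(1) that by (intro openin_fst_imp_snd clo) (auto simp: displacement_def)
  qed (use C in auto)
  have fW0: "(t, f t) \<in> W0" if "t \<in> cube k" for t
  proof -
    have "f t \<notin> D" if "t \<in> far" using C(3) that \<open>t \<in> cube k\<close> by (auto simp: far_def bad_def)
    moreover have "f t \<in> U c" if "c \<in> C" "t \<in> cball c (2 * e c)" for c
      using eU(4)[of c] C(1) that \<open>t \<in> cube k\<close> by blast
    ultimately show ?thesis using that W(2) fZ by (auto simp: W0_def)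
  qed
  have "\<exists>g. homotopic_with ?P ?T Z f g \<and> (\<forall>t\<in>cube k. (t, g t) \<in> W0) \<and>
      (\<forall>c\<in>C'. \<forall>t\<in>cube k \<inter> cball c (e c). g t \<notin> D)" if "finite C'" "C' \<subseteq> C" for C'
    using that
  proof (induction C')
    case empty
    then show ?case using f A(3) fW0 by (intro exI[of _ f]) auto
  next
    case (insert c C')
    then obtain g where g: "homotopic_with ?P ?T Z f g" "\<forall>t\<in>cube k. (t, g t) \<in> W0"
        "\<forall>c\<in>C'. \<forall>t\<in>cube k \<inter> cball c (e c). g t \<notin> D"
      by auto
    have gc: "continuous_map ?T Z g" and gA: "\<And>t. t \<in> A \<Longrightarrow> g t = f0 t"
      using homotopic_with_imp_continuous_maps[OF g(1)] homotopic_with_imp_property[OF g(1)] by auto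
    have gZ: "g t \<in> topspace Z" if "t \<in> cube k" for t
      using gc that by (auto simp: continuous_map_def)
    define W1 where "W1 = W0 \<inter> ?G (\<Union>c\<in>C'. cball c (e c)) (topspace Z - D)"
    have W1: "openin (prod_topology ?T Z) W1"
      unfolding W1_def using W0 D(2) insert.hyps(1)
      by (intro openin_Int openin_fst_imp_snd clo closed_UN) auto
    have gW1: "(t, g t) \<in> W1" if "t \<in> cube k" for t
      using that g(2,3) gZ by (auto simp: W1_def)
    have c: "c \<in> bad" "c \<in> C" using insert.prems C(1) by auto
    have gU: "g ` (cube k \<inter> cball c (2 * e c)) \<subseteq> U c"
      using g(2) c(2) by (fastforce simp: W0_def)
    obtain g' where g': "homotopic_with ?P ?T Z g g'" "\<And>t. t \<in> cube k \<Longrightarrow> (t, g' t) \<in> W1"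
        "\<And>t. t \<in> cube k \<inter> cball c (e c) \<Longrightarrow> g' t \<notin> D"
      using displace_near_point[OF \<open>k < d\<close> gc W1 gW1 A(2) gA eU(1)[OF c(1)] eU(3)[OF c(1)]
            eU(2)[OF c(1)] gU] by blast
    have "g' t \<notin> D" if "c' \<in> C'" "t \<in> cube k \<inter> cball c' (e c')" for c' t
      using g'(2)[of t] that by (auto simp: W1_def)
    then show ?case
      using homotopic_with_trans[OF g(1) g'(1)] g'(2,3) by (intro exI[of _ g']) (auto simp: W1_def)
  qed
  from this[OF C(2) subset_refl]
  obtain g where g: "homotopic_with ?P ?T Z f g" "\<And>t. t \<in> cube k \<Longrightarrow> (t, g t) \<in> W0"
      "\<And>c t. c \<in> C \<Longrightarrow> t \<in> cube k \<inter> cball c (e c) \<Longrightarrow> g t \<notin> D"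
    by blast
  show ?thesis
  proof (rule that[of g])
    show "g t \<notin> D" if "t \<in> cube k" for t
    proof (cases "t \<in> far")
      case True
      then show ?thesis using g(2)[OF that] that by (auto simp: W0_def)
    next
      case False
      then obtain c where "c \<in> C" "t \<in> ball c (e c)" by (auto simp: far_def)
      then show ?thesis using g(3)[of c t] that by auto
    qed
  qed (use g in \<open>auto simp: W0_def\<close>)
qed

text \<open>The members are treated one at a time: avoiding those already treated is an open condition on the
  graph.\<close>

lemma displace_off_finite_family:
  assumes "k < d" "finite \<D>" and "\<And>D. D \<in> \<D> \<Longrightarrow> displaceable d Z D" "\<And>D. D \<in> \<D> \<Longrightarrow> closedin Z D"
    and f: "continuous_map (cube_topology k) Z f"
    and A: "closed A" "A \<subseteq> cube k" "\<And>t. t \<in> A \<Longrightarrow> f t \<notin> \<Union>\<D>"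
  obtains g where "homotopic_with (\<lambda>h. \<forall>t\<in>A. h t = f t) (cube_topology k) Z f g"
    "\<And>t. t \<in> cube k \<Longrightarrow> g t \<notin> \<Union>\<D>"
proof -
  let ?T = "cube_topology k" and ?P = "\<lambda>h. \<forall>t\<in>A. h t = f t"
  have "\<exists>g. homotopic_with ?P ?T Z f g \<and> (\<forall>t\<in>cube k. g t \<notin> \<Union>\<D>)"
    using assms(2-4) A(3)
  proof (induction \<D>)
    case empty
    then show ?case using f by (intro exI[of _ f]) auto
  next
    case (insert D \<D>)
    then obtain g where g: "homotopic_with ?P ?T Z f g" "\<forall>t\<in>cube k. g t \<notin> \<Union>\<D>"
      by auto
    have gc: "continuous_map ?T Z g" and gA: "\<And>t. t \<in> A \<Longrightarrow> g t = f t"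
      using homotopic_with_imp_continuous_maps[OF g(1)] homotopic_with_imp_property[OF g(1)] by auto
    define W where "W = cube k \<times> (topspace Z - \<Union>\<D>)"
    have "closedin Z (\<Union>\<D>)" using insert by (intro closedin_Union) auto
    then have W: "openin (prod_topology ?T Z) W"
      unfolding W_def openin_prod_Times_iff
      by (metis openin_topspace topspace_cube_topology closedin_def)
    have gW: "(t, g t) \<in> W" if "t \<in> cube k" for t
      using that g(2) gc by (auto simp: W_def continuous_map_def)
    have gD: "g t \<notin> D" if "t \<in> A" for t using insert.prems(3)[OF that] gA[OF that] by auto
    obtain g' where g': "homotopic_with ?P ?T Z g g'" "\<And>t. t \<in> cube k \<Longrightarrow> (t, g' t) \<in> W"
        "\<And>t. t \<in> cube k \<Longrightarrow> g' t \<notin> D"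
      using displace_off[OF \<open>k < d\<close> insert.prems(1,2)[OF insertI1] gc W gW A(1,2) gA gD] by blast
    show ?case
      using homotopic_with_trans[OF g(1) g'(1)] g'(2,3) by (intro exI[of _ g']) (auto simp: W_def)
  qed
  then obtain g where "homotopic_with ?P ?T Z f g \<and> (\<forall>t\<in>cube k. g t \<notin> \<Union>\<D>)" ..
  then show ?thesis by (intro that[of g]) simp_all
qed

section \<open>The diagonals of a power of a manifold\<close>

lemma Euclidean_space_eq: "Euclidean_space d = top_of_set {w. \<forall>i\<ge>d. w i = 0}"
  unfolding Euclidean_space_def by (simp add: euclidean_product_topology)

lemma continuous_map_euclidean_sequence:
  fixes f :: "'b \<Rightarrow> nat \<Rightarrow> real"
  shows "continuous_map X euclidean f \<longleftrightarrow> (\<forall>i. continuous_map X euclideanreal (\<lambda>x. f x i))"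
  unfolding euclidean_product_topology[symmetric] by (rule continuous_map_componentwise_UNIV)

text \<open>The topology on sequences is the product topology, so an open set contains cubes in any finite
  number of coordinates, by the tube lemma for the scaling map.\<close>

lemma open_contains_coordinate_cube:
  fixes a :: "nat \<Rightarrow> real"
  assumes "open V" "a \<in> V"
  obtains \<delta> where "\<delta> > 0" "\<And>v s. v \<in> centred_cube d \<Longrightarrow> 0 \<le> s \<Longrightarrow> s \<le> \<delta> \<Longrightarrow> (\<lambda>i. a i + s * v i) \<in> V"
proof -
  let ?B = "top_of_set (centred_cube d)" and ?I = "top_of_set {0..1::real}"
  define W where "W = {x \<in> topspace (prod_topology ?B ?I). (\<lambda>i. a i + snd x * fst x i) \<in> V}"
  have "continuous_on (centred_cube d \<times> {0..1}) (\<lambda>x i. a i + snd x * fst x i)"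
    by (rule continuous_on_coordinatewise_then_product)
      (intro continuous_on_add continuous_on_mult continuous_on_const continuous_on_snd continuous_on_id
        continuous_on_product_then_coordinatewise[OF continuous_on_fst[OF continuous_on_id]])
  then have "continuous_map (prod_topology ?B ?I) euclidean (\<lambda>x i. a i + snd x * fst x i)"
    by simp
  then have W: "openin (prod_topology ?B ?I) W"
    unfolding W_def by (rule openin_continuous_map_preimage) (use assms(1) in simp)
  have B: "compact_space ?B"
    using compact_centred_cube by (simp add: compact_space_subtopology)
  have W0: "(v, 0) \<in> W" if "v \<in> topspace ?B" for v
    using that assms(2) by (auto simp: W_def)
  obtain \<delta> where \<delta>: "\<delta> > 0" "\<And>v s. v \<in> topspace ?B \<Longrightarrow> 0 \<le> s \<Longrightarrow> s \<le> \<delta> \<Longrightarrow> (v, s) \<in> W"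
    by (rule interval_tube[OF B W]) (erule W0, rule that)
  show ?thesis
  proof (rule that[OF \<delta>(1)])
    show "(\<lambda>i. a i + s * v i) \<in> V" if "v \<in> centred_cube d" "0 \<le> s" "s \<le> \<delta>" for v s
      using \<delta>(2)[of v s] that by (simp add: W_def)
  qed
qed

text \<open>Translation in a chart, rescaled so that all of \<open>[-1, 1]\<^sup>d\<close> can act: \<open>U\<close> is a cube of half the size
  available in the chart, translations have up to the same half size, and \<open>\<psi>\<close> is the chart divided by that
  half size.\<close>

lemma manifold_translations:
  assumes "topological_manifold d X" "p \<in> topspace X"
  obtains U \<psi> m where "openin X U" "p \<in> U"
    "continuous_map (subtopology X U) euclidean (\<psi> :: 'a \<Rightarrow> nat \<Rightarrow> real)"
    "continuous_map (prod_topology (subtopology X U) (top_of_set (centred_cube d))) X m"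
    "\<And>y. y \<in> U \<Longrightarrow> m (y, \<lambda>_. 0) = y"
    "\<And>y v. y \<in> U \<Longrightarrow> v \<in> centred_cube d \<Longrightarrow> m (y, v) \<in> U \<Longrightarrow> v = (\<lambda>i. \<psi> (m (y, v)) i - \<psi> y i)"
proof -
  obtain U0 V where UV: "openin X U0" "p \<in> U0" "openin (Euclidean_space d) V"
      "subtopology X U0 homeomorphic_space subtopology (Euclidean_space d) V"
    using assms unfolding topological_manifold_def by blast
  let ?E = "{w :: nat \<Rightarrow> real. \<forall>i\<ge>d. w i = 0}"
  have VE: "V \<subseteq> ?E" using openin_subset[OF UV(3)] by (simp add: topspace_Euclidean_space)
  then have EV: "subtopology (Euclidean_space d) V = top_of_set V"
    by (simp add: Euclidean_space_eq subtopology_subtopology inf.absorb2)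
  have topU0: "topspace (subtopology X U0) = U0"
    using openin_subset[OF UV(1)] by auto
  obtain h h' where hh: "continuous_map (subtopology X U0) (top_of_set V) h"
      "continuous_map (top_of_set V) (subtopology X U0) h'"
      "\<And>y. y \<in> U0 \<Longrightarrow> h' (h y) = y" "\<And>w. w \<in> V \<Longrightarrow> h (h' w) = w"
    using UV(4) unfolding homeomorphic_space_def homeomorphic_maps_def EV topU0 by auto
  have hV: "h y \<in> V" if "y \<in> U0" for y using hh(1) that topU0 by (auto simp: continuous_map_def)
  obtain V' where V': "open V'" "V = ?E \<inter> V'"
    using UV(3) unfolding Euclidean_space_eq openin_open by blast
  obtain \<delta> where \<delta>: "\<delta> > 0" "\<And>v s. v \<in> centred_cube d \<Longrightarrow> 0 \<le> s \<Longrightarrow> s \<le> \<delta> \<Longrightarrow> (\<lambda>i. h p i + s * v i) \<in> V'"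
    using open_contains_coordinate_cube[OF V'(1), of "h p" d] hV[OF UV(2)] V'(2) by auto
  define \<epsilon> where "\<epsilon> = \<delta> / 2"
  have \<epsilon>: "\<epsilon> > 0" using \<delta>(1) by (simp add: \<epsilon>_def)
  define U where "U = {y \<in> U0. \<forall>i<d. \<bar>h y i - h p i\<bar> < \<epsilon>}"
  define O' where "O' = (\<Inter>i<d. {w :: nat \<Rightarrow> real. \<bar>w i - h p i\<bar> < \<epsilon>})"
  have "open O'"
    unfolding O'_def
    by (intro open_INT ballI open_Collect_less continuous_on_rabs continuous_on_diff continuous_on_const
        continuous_on_product_then_coordinatewise[OF continuous_on_id]) auto
  then have "openin (top_of_set V) (V \<inter> O')" by blast
  from openin_continuous_map_preimage[OF hh(1) this]
  moreover have "{y \<in> topspace (subtopology X U0). h y \<in> V \<inter> O'} = U"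
    unfolding topU0 using hV by (auto simp: U_def O'_def)
  ultimately have "openin (subtopology X U0) U" by simp
  then have U: "openin X U" using UV(1) by (rule openin_trans_full)
  have shift: "(\<lambda>i. h y i + \<epsilon> * v i) \<in> V" if "y \<in> U" "v \<in> centred_cube d" for y v
  proof -
    define w where "w = (\<lambda>i. (h y i + \<epsilon> * v i - h p i) / \<delta>)"
    have E: "h y i = 0" "h p i = 0" "v i = 0" if "i \<ge> d" for i
      using that hV[of y] hV[OF UV(2)] VE \<open>y \<in> U\<close> \<open>v \<in> _\<close> by (auto simp: U_def centred_cube_def)
    have "\<bar>w i\<bar> \<le> 1" if "i < d" for i
    proof -
      have "\<bar>h y i - h p i\<bar> < \<epsilon>" using \<open>y \<in> U\<close> that by (auto simp: U_def)
      moreover have "\<bar>\<epsilon> * v i\<bar> \<le> \<epsilon>"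
        using \<open>v \<in> _\<close> that \<epsilon> by (simp add: centred_cube_def abs_mult)
      ultimately have "\<bar>h y i + \<epsilon> * v i - h p i\<bar> \<le> \<delta>" unfolding \<epsilon>_def by linarith
      then show ?thesis using \<delta>(1) by (simp add: w_def)
    qed
    then have "w \<in> centred_cube d" using E by (auto simp: centred_cube_def w_def)
    then have "(\<lambda>i. h p i + \<delta> * w i) \<in> V'" using \<delta> by (intro \<delta>(2)) auto
    then have "(\<lambda>i. h y i + \<epsilon> * v i) \<in> V'" using \<delta>(1) by (simp add: w_def)
    then show ?thesis using V'(2) E by auto
  qed
  define m where "m = (\<lambda>(y, v). h' (\<lambda>i. h y i + \<epsilon> * v i))"
  let ?P = "prod_topology (subtopology X U) (top_of_set (centred_cube d))"
  have UU0: "U \<subseteq> U0" by (auto simp: U_def)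
  have hU: "continuous_map (subtopology X U) euclidean h"
    using continuous_map_from_subtopology_mono[OF _ UU0] hh(1) by (metis continuous_map_into_fulltopology)
  have hUi: "continuous_map (subtopology X U) euclideanreal (\<lambda>y. h y i)" for i
    using hU by (simp add: continuous_map_euclidean_sequence)
  have m: "continuous_map ?P X m"
  proof -
    have "continuous_map ?P euclidean (\<lambda>x i. h (fst x) i + \<epsilon> * snd x i)"
      unfolding continuous_map_euclidean_sequence
    proof
      fix i
      have "continuous_map ?P euclideanreal (\<lambda>x. h (fst x) i)"
        using continuous_map_compose[OF continuous_map_fst hUi] by (simp add: o_def)
      moreover have "continuous_map (top_of_set (centred_cube d)) euclideanreal (\<lambda>v. v i)"
        using continuous_on_product_then_coordinatewise[OF continuous_on_id] by simp
      from continuous_map_compose[OF continuous_map_snd this]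
      have "continuous_map ?P euclideanreal (\<lambda>x. snd x i)" by (simp add: o_def)
      ultimately show "continuous_map ?P euclideanreal (\<lambda>x. h (fst x) i + \<epsilon> * snd x i)"
        by (intro continuous_map_add continuous_map_real_mult) auto
    qed
    then have "continuous_map ?P (top_of_set V) (\<lambda>x i. h (fst x) i + \<epsilon> * snd x i)"
      using shift by (auto simp: continuous_map_in_subtopology)
    from continuous_map_compose[OF this hh(2)]
    have "continuous_map ?P (subtopology X U0) m" by (simp add: m_def o_def case_prod_unfold)
    then show ?thesis by (rule continuous_map_into_fulltopology)
  qed
  have \<psi>: "continuous_map (subtopology X U) euclidean (\<lambda>y i. h y i / \<epsilon>)"
    unfolding continuous_map_euclidean_sequence using hUi \<epsilon> by (auto intro: continuous_map_real_divide)
  show ?thesis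
  proof (rule that[OF U _ \<psi> m])
    show "p \<in> U" using UV(2) \<epsilon> by (simp add: U_def)
    show "m (y, \<lambda>_. 0) = y" if "y \<in> U" for y using that UU0 hh(3) by (auto simp: m_def)
    show "v = (\<lambda>i. h (m (y, v)) i / \<epsilon> - h y i / \<epsilon>)" if "y \<in> U" "v \<in> centred_cube d" for y v
      using shift[OF that] \<epsilon> by (auto simp: m_def hh(4) fun_eq_iff field_simps)
  qed
qed

text \<open>Only the \<open>i\<close>-th point of a tuple is moved, by translation in a chart around the common value of the
  \<open>i\<close>-th and \<open>j\<close>-th points. It reaches the \<open>j\<close>-th point for just one translation vector, the difference
  of their coordinates.\<close>

lemma diagonal_displaceable:
  assumes X: "topological_manifold d X" and ij: "i \<in> {1..n}" "j \<in> {1..n}" "i \<noteq> j"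
  shows "displaceable d (power_space n X) {y \<in> topspace (power_space n X). y i = y j}"
  unfolding displaceable_def
proof
  let ?Z = "power_space n X" and ?D = "{y \<in> topspace (power_space n X). y i = y j}"
  fix z assume z: "z \<in> topspace ?Z \<inter> ?D"
  have zi: "z i \<in> topspace X" using z ij by auto
  obtain U \<psi> m where U: "openin X U" "z i \<in> U"
    "continuous_map (subtopology X U) euclidean (\<psi> :: 'a \<Rightarrow> nat \<Rightarrow> real)"
    "continuous_map (prod_topology (subtopology X U) (top_of_set (centred_cube d))) X m"
    "\<And>y. y \<in> U \<Longrightarrow> m (y, \<lambda>_. 0) = y"
    "\<And>y v. y \<in> U \<Longrightarrow> v \<in> centred_cube d \<Longrightarrow> m (y, v) \<in> U \<Longrightarrow> v = (\<lambda>l. \<psi> (m (y, v)) l - \<psi> y l)"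
    by (rule manifold_translations[OF X zi]) (rule that)
  define U' where "U' = {y \<in> topspace ?Z. y i \<in> U} \<inter> {y \<in> topspace ?Z. y j \<in> U}"
  define M where "M = (\<lambda>(y, v). (y :: nat \<Rightarrow> 'a)(i := m (y i, v)))"
  define q where "q = (\<lambda>y l. \<psi> (y j) l - \<psi> (y i) l)"
  let ?B = "top_of_set (centred_cube d)"
  let ?P = "prod_topology (subtopology ?Z U') ?B"
  have proj: "continuous_map ?Z X (\<lambda>y. y l)" if "l \<in> {1..n}" for l
    using that by (rule continuous_map_product_projection)
  have projU: "continuous_map (subtopology ?Z U') (subtopology X U) (\<lambda>y. y l)" if "l \<in> {i, j}" for l
    using continuous_map_from_subtopology[OF proj[of l]] that ij
    by (auto simp: continuous_map_in_subtopology U'_def)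
  show "\<exists>U M q. displacement d ?Z ?D U M q \<and> z \<in> U"
    unfolding displacement_def
  proof (intro exI[of _ U'] exI[of _ M] exI[of _ q] conjI ballI impI)
    show "openin ?Z U'"
      unfolding U'_def by (intro openin_Int openin_continuous_map_preimage[OF proj] ij U(1))
    show "z \<in> U'" using z U(2) by (auto simp: U'_def)
    show "continuous_map ?P ?Z M"
      unfolding continuous_map_componentwise
    proof (intro conjI ballI)
      show "M ` topspace ?P \<subseteq> extensional {1..n}"
        using ij by (auto simp: M_def U'_def extensional_def PiE_iff)
      fix l assume l: "l \<in> {1..n}"
      have "continuous_map ?P X (\<lambda>x. M x i)"
      proof -
        have "continuous_map ?P (subtopology X U) (\<lambda>x. fst x i)"
          using continuous_map_compose[OF continuous_map_fst projU[of i]] by (simp add: o_def)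
        then have "continuous_map ?P (prod_topology (subtopology X U) ?B) (\<lambda>x. (fst x i, snd x))"
          by (intro continuous_map_pairedI continuous_map_snd)
        from continuous_map_compose[OF this U(4)]
        show ?thesis by (simp add: M_def o_def case_prod_unfold)
      qed
      moreover have "continuous_map ?P X (\<lambda>x. M x l)" if "l \<noteq> i"
      proof -
        have "continuous_map ?P X (\<lambda>x. fst x l)"
          using continuous_map_compose[OF continuous_map_fst continuous_map_from_subtopology[OF proj[OF l]]]
          by (simp add: o_def)
        then show ?thesis using that by (simp add: M_def case_prod_unfold)
      qed
      ultimately show "continuous_map ?P X (\<lambda>x. M x l)" by (cases "l = i") auto
    qed
    have "continuous_map (subtopology ?Z U') euclideanreal (\<lambda>y. \<psi> (y l') l)" if "l' \<in> {i, j}" for l l'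
      using continuous_map_compose[OF projU[OF that] U(3)]
      by (simp add: o_def continuous_map_euclidean_sequence)
    then show "continuous_map (subtopology ?Z U') euclidean q"
      unfolding continuous_map_euclidean_sequence q_def
      by (auto intro: continuous_map_diff)
    show "M (y, \<lambda>_. 0) = y" if "y \<in> U'" for y
      using that U(5) by (auto simp: M_def U'_def)
    show "v = q y" if "y \<in> U'" "v \<in> centred_cube d" "M (y, v) \<in> ?D" for y v
    proof -
      have eq: "m (y i, v) = y j" using that(3) ij(3) by (simp add: M_def)
      have "y i \<in> U" "y j \<in> U" using that(1) by (auto simp: U'_def)
      with U(6)[of "y i" v] eq that(2) show ?thesis by (simp add: q_def)
    qed
  qed
qed

section \<open>Configuration spaces and homotopy groups\<close>

lemma closed_cube_boundary: "closed (cube_boundary k)"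
proof -
  have "cube_boundary k = cube k \<inter> (\<Union>i<k. {t. t i = 0} \<union> {t. t i = 1})"
    by (auto simp: cube_boundary_def)
  moreover have "closed {t :: nat \<Rightarrow> real. t i = c}" for i c
    by (intro closed_Collect_eq continuous_on_const continuous_on_product_then_coordinatewise[OF continuous_on_id])
  ultimately show ?thesis
    using compact_imp_closed[OF compact_cube] by (auto intro!: closed_Int closed_UN closed_Un)
qed

text \<open>The configuration space is the complement of the finitely many diagonals, which are closed because
  \<open>X\<close> is Hausdorff.\<close>

lemma deform_into_configuration_space:
  assumes X: "topological_manifold d X" and "k < d"
    and f: "continuous_map (cube_topology k) (power_space n X) f"
    and bd: "\<And>t. t \<in> cube_boundary k \<Longrightarrow> f t \<in> topspace (configuration_space n X)"
  obtains g where "homotopic_with (\<lambda>h. \<forall>t\<in>cube_boundary k. h t = f t) (cube_topology k) (power_space n X) f g"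
    "continuous_map (cube_topology k) (configuration_space n X) g"
proof -
  let ?Z = "power_space n X"
  define \<Delta> where "\<Delta> = (\<lambda>i j. {y \<in> topspace ?Z. y i = y j})"
  define \<D> where "\<D> = {\<Delta> i j | i j. i \<in> {1..n} \<and> j \<in> {1..n} \<and> i \<noteq> j}"
  have "y \<in> \<Union>\<D> \<longleftrightarrow> (\<exists>i\<in>{1..n}. \<exists>j\<in>{1..n}. i \<noteq> j \<and> y \<in> \<Delta> i j)" for y
    unfolding \<D>_def by blast
  then have conf: "y \<in> topspace (configuration_space n X) \<longleftrightarrow> y \<in> topspace ?Z \<and> y \<notin> \<Union>\<D>" for y
    unfolding configuration_space_def \<Delta>_def topspace_subtopology Int_iff mem_Collect_eq by meson
  have "\<D> \<subseteq> (\<lambda>(i, j). \<Delta> i j) ` ({1..n} \<times> {1..n})" unfolding \<D>_def by auto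
  then have fin: "finite \<D>" by (rule finite_subset) auto
  have disp: "displaceable d ?Z D" and clos: "closedin ?Z D" if "D \<in> \<D>" for D
  proof -
    obtain i j where ij: "i \<in> {1..n}" "j \<in> {1..n}" "i \<noteq> j" and D: "D = {y \<in> topspace ?Z. y i = y j}"
      using \<open>D \<in> \<D>\<close> unfolding \<D>_def \<Delta>_def by blast
    have H: "Hausdorff_space X" using X by (simp add: topological_manifold_def)
    show "closedin ?Z D"
      unfolding D by (intro closedin_continuous_maps_eq[OF H] continuous_map_product_projection ij)
    show "displaceable d ?Z D"
      unfolding D by (rule diagonal_displaceable[OF X ij])
  qed
  have bd': "f t \<notin> \<Union>\<D>" if "t \<in> cube_boundary k" for t
    using bd[OF that] conf by blast
  have sub: "cube_boundary k \<subseteq> cube k" by (auto simp: cube_boundary_def)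
  obtain g where g: "homotopic_with (\<lambda>h. \<forall>t\<in>cube_boundary k. h t = f t) (cube_topology k) ?Z f g"
    "\<And>t. t \<in> cube k \<Longrightarrow> g t \<notin> \<Union>\<D>"
    by (rule displace_off_finite_family[OF \<open>k < d\<close> fin _ _ f closed_cube_boundary sub])
      (erule disp, erule clos, erule bd', rule that)
  have gc: "continuous_map (cube_topology k) ?Z g"
    using homotopic_with_imp_continuous_maps[OF g(1)] by simp
  have "g t \<in> topspace (configuration_space n X)" if "t \<in> cube k" for t
    using that g(2) gc by (auto simp: conf continuous_map_def)
  then have "continuous_map (cube_topology k) (configuration_space n X) g"
    using gc by (fastforce simp: configuration_space_def continuous_map_in_subtopology)
  then show ?thesis using that g(1) by blast
qed

lemma cube_class_eq_iff:
  assumes "f \<in> cube_maps j X x0"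
  shows "cube_class j X x0 f = cube_class j X x0 g \<longleftrightarrow> cube_homotopic j X x0 f g"
proof
  assume "cube_class j X x0 f = cube_class j X x0 g"
  moreover have "f \<in> cube_class j X x0 f" using assms by (simp add: cube_class_def cube_homotopic_refl_iff)
  ultimately have "f \<in> cube_class j X x0 g" by simp
  then show "cube_homotopic j X x0 f g" by (simp add: cube_class_def cube_homotopic_sym)
qed (rule cube_class_eqI)

lemma continuous_map_configuration_space_id:
  "continuous_map (configuration_space n X) (power_space n X) id"
  by (simp add: configuration_space_def continuous_map_from_subtopology)

lemma surjective_on_homotopy_groups:
  assumes X: "topological_manifold d X" and "j < d" and x: "x \<in> topspace (configuration_space n X)"
  shows "homotopy_group_map j (power_space n X) x id ` carrier (homotopy_group j (configuration_space n X) x)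
         = carrier (homotopy_group j (power_space n X) x)"
proof -
  let ?Z = "power_space n X" and ?F = "configuration_space n X"
  have map: "homotopy_group_map j ?Z x id (cube_class j ?F x f) = cube_class j ?Z x f"
    if "f \<in> cube_maps j ?F x" for f
    using homotopy_group_map_cube_class[OF continuous_map_configuration_space_id _ that] by simp
  have inc: "f \<in> cube_maps j ?Z x" if "f \<in> cube_maps j ?F x" for f
    using that continuous_map_compose[OF _ continuous_map_configuration_space_id] by (auto simp: cube_maps_def)
  have "\<exists>g\<in>cube_maps j ?F x. cube_class j ?Z x f = cube_class j ?Z x g" if "f \<in> cube_maps j ?Z x" for f
  proof -
    have f: "continuous_map (cube_topology j) ?Z f" "\<And>t. t \<in> cube_boundary j \<Longrightarrow> f t = x"
      using that by (auto simp: cube_maps_def)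
    have bd: "f t \<in> topspace ?F" if "t \<in> cube_boundary j" for t using f(2)[OF that] x by simp
    obtain g where g: "homotopic_with (\<lambda>h. \<forall>t\<in>cube_boundary j. h t = f t) (cube_topology j) ?Z f g"
        "continuous_map (cube_topology j) ?F g"
      by (rule deform_into_configuration_space[OF X \<open>j < d\<close> f(1)]) (erule bd, rule that)
    have "\<forall>t\<in>cube_boundary j. g t = f t" using homotopic_with_imp_property[OF g(1)] by simp
    then have "g \<in> cube_maps j ?F x" using g(2) f(2) by (auto simp: cube_maps_def)
    moreover have "cube_homotopic j ?Z x f g"
      unfolding cube_homotopic_def by (rule homotopic_with_mono[OF g(1)]) (use f(2) in auto)
    ultimately show ?thesis using cube_class_eqI by metis
  qed
  then show ?thesis
    using map inc by (auto simp: homotopy_group_def image_iff)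
qed

lemma continuous_on_update:
  fixes g :: "'b::topological_space \<Rightarrow> nat \<Rightarrow> real"
  assumes "continuous_on S g" "continuous_on S a"
  shows "continuous_on S (\<lambda>x. (g x)(j := a x))"
proof (rule continuous_on_coordinatewise_then_product)
  show "continuous_on S (\<lambda>x. ((g x)(j := a x)) i)" for i
    using assms continuous_on_product_then_coordinatewise[OF assms(1)] by (cases "i = j") auto
qed

text \<open>A homotopy between maps of the \<open>j\<close>-cube is read as a map \<open>G\<close> of the \<open>(j + 1)\<close>-cube whose last
  coordinate, with index \<open>j\<close>, is time. Its boundary consists of the two end maps and the constant
  homotopy on the boundary of the \<open>j\<close>-cube, all in the configuration space, so it can be deformed into
  the configuration space without changing these.\<close>

lemma homotopy_lifts_to_configuration_space:
  assumes X: "topological_manifold d X" and "Suc j < d" and x: "x \<in> topspace (configuration_space n X)"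
    and f: "f \<in> cube_maps j (configuration_space n X) x" and g: "g \<in> cube_maps j (configuration_space n X) x"
    and fg: "cube_homotopic j (power_space n X) x f g"
  shows "cube_homotopic j (configuration_space n X) x f g"
proof -
  let ?Z = "power_space n X" and ?F = "configuration_space n X" and ?I = "top_of_set {0..1::real}"
  have prodeq: "prod_topology ?I (cube_topology j) = top_of_set ({0..1::real} \<times> cube j)"
    by (simp add: cube_topology_eq)
  obtain H where H: "continuous_map (prod_topology ?I (cube_topology j)) ?Z H"
      "\<And>t. H (0, t) = f t" "\<And>t. H (1, t) = g t"
      "\<And>s t. s \<in> {0..1} \<Longrightarrow> t \<in> cube_boundary j \<Longrightarrow> H (s, t) = x"
    using fg unfolding cube_homotopic_def homotopic_with_def by (auto simp: image_subset_iff)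
  have split: "t j \<in> {0..1} \<and> t(j := 0) \<in> cube j" if "t \<in> cube (Suc j)" for t
    using that by (auto simp: cube_def)
  have join: "t(j := s) \<in> cube (Suc j)" if "t \<in> cube j" "s \<in> {0..1}" for s t
    using that by (auto simp: cube_def)
  have fF: "f t \<in> topspace ?F" "g t \<in> topspace ?F" if "t \<in> cube j" for t
    using f g that by (auto simp: cube_maps_def continuous_map_def)
  have fx: "f t = x" "g t = x" if "t \<in> cube_boundary j" for t
    using f g that by (auto simp: cube_maps_def)
  define G where "G = (\<lambda>t. H (t j, t(j := 0)))"
  have "continuous_on (cube (Suc j)) (\<lambda>t. (t j, t(j := 0)))"
    by (intro continuous_on_Pair continuous_on_update continuous_on_id continuous_on_const
        continuous_on_product_then_coordinatewise[OF continuous_on_id])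
  then have "continuous_map (cube_topology (Suc j)) (prod_topology ?I (cube_topology j)) (\<lambda>t. (t j, t(j := 0)))"
    unfolding prodeq cube_topology_eq using split by auto
  from continuous_map_compose[OF this H(1)]
  have G: "continuous_map (cube_topology (Suc j)) ?Z G" by (simp add: G_def o_def)
  have boundary: "t j = 0 \<or> t j = 1 \<or> t(j := 0) \<in> cube_boundary j" if "t \<in> cube_boundary (Suc j)" for t
  proof -
    obtain i where i: "t \<in> cube (Suc j)" "i < Suc j" "t i = 0 \<or> t i = 1"
      using \<open>t \<in> cube_boundary (Suc j)\<close> by (auto simp: cube_boundary_def)
    show ?thesis
    proof (cases "i = j")
      case False
      then show ?thesis using i split[OF i(1)] by (auto simp: cube_boundary_def intro!: exI[of _ i])
    qed (use i in auto)
  qed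
  have Gbd: "G t \<in> topspace ?F" if "t \<in> cube_boundary (Suc j)" for t
  proof -
    have "t \<in> cube (Suc j)" using that by (simp add: cube_boundary_def)
    from split[OF this] boundary[OF that] show ?thesis
      using H(2-4) fF x by (auto simp: G_def)
  qed
  obtain G' where G': "homotopic_with (\<lambda>h. \<forall>t\<in>cube_boundary (Suc j). h t = G t) (cube_topology (Suc j)) ?Z G G'"
      "continuous_map (cube_topology (Suc j)) ?F G'"
    by (rule deform_into_configuration_space[OF X \<open>Suc j < d\<close> G]) (erule Gbd, rule that)
  have GG': "G' t = G t" if "t \<in> cube_boundary (Suc j)" for t
    using homotopic_with_imp_property[OF G'(1)] that by simp
  define K where "K = (\<lambda>(s, t :: nat \<Rightarrow> real). G' (t(j := s)))"
  have "continuous_on ({0..1} \<times> cube j) (\<lambda>p. (snd p)(j := fst p))"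
    by (intro continuous_on_update continuous_intros)
  then have "continuous_map (prod_topology ?I (cube_topology j)) (cube_topology (Suc j)) (\<lambda>p. (snd p)(j := fst p))"
    unfolding prodeq cube_topology_eq using join by auto
  from continuous_map_compose[OF this G'(2)]
  have K: "continuous_map (prod_topology ?I (cube_topology j)) ?F K"
    by (simp add: K_def o_def case_prod_unfold)
  have tj: "t j = 0" if "t \<in> cube j" for t using that by (simp add: cube_def)
  have K0: "K (0, t) = f t" and K1: "K (1, t) = g t" if t: "t \<in> cube j" for t
  proof -
    have "t(j := 0) \<in> cube_boundary (Suc j)" "t(j := 1) \<in> cube_boundary (Suc j)"
      using join[OF t] by (auto simp: cube_boundary_def intro!: exI[of _ j])
    moreover have "t(j := 0) = t" using tj[OF t] by auto
    ultimately show "K (0, t) = f t" "K (1, t) = g t"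
      using H(2,3) tj[OF t] by (simp_all add: K_def GG' G_def)
  qed
  have Kb: "K (s, t) = x" if "t \<in> cube_boundary j" "s \<in> {0..1}" for s t
  proof -
    have t: "t \<in> cube j" using that by (simp add: cube_boundary_def)
    obtain i where i: "i < j" "t i = 0 \<or> t i = 1" using \<open>t \<in> cube_boundary j\<close> by (auto simp: cube_boundary_def)
    then have "t(j := s) \<in> cube_boundary (Suc j)"
      using join[OF t that(2)] by (auto simp: cube_boundary_def intro!: exI[of _ i])
    moreover have "t(j := 0) = t" using tj[OF t] by auto
    ultimately show ?thesis using H(4)[OF that(2,1)] by (simp add: K_def GG' G_def)
  qed
  show ?thesis
    unfolding cube_homotopic_def
  proof (subst homotopic_with)
    show "h ` cube_boundary j \<subseteq> {x} \<longleftrightarrow> k ` cube_boundary j \<subseteq> {x}"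
      if "\<And>t. t \<in> topspace (cube_topology j) \<Longrightarrow> h t = k t" for h k
      using that by (auto simp: cube_boundary_def image_subset_iff)
    show "\<exists>h. continuous_map (prod_topology ?I (cube_topology j)) ?F h \<and>
        (\<forall>t\<in>topspace (cube_topology j). h (0, t) = f t) \<and> (\<forall>t\<in>topspace (cube_topology j). h (1, t) = g t) \<and>
        (\<forall>s\<in>{0..1}. (\<lambda>t. h (s, t)) ` cube_boundary j \<subseteq> {x})"
      using K K0 K1 Kb by (intro exI[of _ K]) auto
  qed
qed

lemma injective_on_homotopy_groups:
  assumes X: "topological_manifold d X" and "Suc j < d" and x: "x \<in> topspace (configuration_space n X)"
  shows "inj_on (homotopy_group_map j (power_space n X) x id)
           (carrier (homotopy_group j (configuration_space n X) x))"
proof (rule inj_onI)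
  let ?Z = "power_space n X" and ?F = "configuration_space n X"
  fix a b assume ab: "a \<in> carrier (homotopy_group j ?F x)" "b \<in> carrier (homotopy_group j ?F x)"
    and eq: "homotopy_group_map j ?Z x id a = homotopy_group_map j ?Z x id b"
  obtain f g where f: "f \<in> cube_maps j ?F x" "a = cube_class j ?F x f"
    and g: "g \<in> cube_maps j ?F x" "b = cube_class j ?F x g"
    using ab by (auto simp: homotopy_group_def)
  have "cube_class j ?Z x f = cube_class j ?Z x g"
    using eq homotopy_group_map_cube_class[OF continuous_map_configuration_space_id _ f(1)]
      homotopy_group_map_cube_class[OF continuous_map_configuration_space_id _ g(1)] f g by simp
  moreover have "f \<in> cube_maps j ?Z x"
    using f(1) continuous_map_compose[OF _ continuous_map_configuration_space_id] by (auto simp: cube_maps_def)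
  ultimately have "cube_homotopic j ?Z x f g" by (simp add: cube_class_eq_iff)
  then show "a = b"
    using homotopy_lifts_to_configuration_space[OF X \<open>Suc j < d\<close> x f(1) g(1)] f(2) g(2) cube_class_eqI by metis
qed

lemma homotopy_group_map_hom:
  assumes "j > 0" "continuous_map X Y \<phi>" "\<phi> x0 = y0"
  shows "homotopy_group_map j Y y0 \<phi> \<in> hom (homotopy_group j X x0) (homotopy_group j Y y0)"
proof (rule homI)
  have push: "\<phi> \<circ> f \<in> cube_maps j Y y0" if "f \<in> cube_maps j X x0" for f
    using that assms(2,3) continuous_map_compose by (auto simp: cube_maps_def image_subset_iff)
  have map: "homotopy_group_map j Y y0 \<phi> (cube_class j X x0 f) = cube_class j Y y0 (\<phi> \<circ> f)"
    if "f \<in> cube_maps j X x0" for f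
    by (rule homotopy_group_map_cube_class[OF assms(2,3) that])
  fix a assume "a \<in> carrier (homotopy_group j X x0)"
  then obtain f where f: "f \<in> cube_maps j X x0" "a = cube_class j X x0 f"
    by (auto simp: homotopy_group_def)
  then show "homotopy_group_map j Y y0 \<phi> a \<in> carrier (homotopy_group j Y y0)"
    using map push by (auto simp: homotopy_group_def)
  fix b assume "b \<in> carrier (homotopy_group j X x0)"
  then obtain g where g: "g \<in> cube_maps j X x0" "b = cube_class j X x0 g"
    by (auto simp: homotopy_group_def)
  have "cube_concat f g \<in> cube_maps j X x0"
    using cube_homotopic_concat[OF assms(1), of X x0 f f g g] f(1) g(1) by (simp add: cube_homotopic_refl_iff)
  moreover have "\<phi> \<circ> cube_concat f g = cube_concat (\<phi> \<circ> f) (\<phi> \<circ> g)"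
    by (auto simp: cube_concat_def)
  ultimately show "homotopy_group_map j Y y0 \<phi> (a \<otimes>\<^bsub>homotopy_group j X x0\<^esub> b)
      = homotopy_group_map j Y y0 \<phi> a \<otimes>\<^bsub>homotopy_group j Y y0\<^esub> homotopy_group_map j Y y0 \<phi> b"
    using f g push by (simp add: map homotopy_group_mult_cube_class[OF assms(1)])
qed

theorem theorem2p2:
  fixes X :: "'a topology" and d n :: nat and x :: "nat \<Rightarrow> 'a"
  assumes "topological_manifold d X" and "connected_space X" and "n \<ge> 1"
    and "x \<in> topspace (configuration_space n X)"
  shows "m_connected_map (int d - 1) (configuration_space n X) x (power_space n X) x id"
  unfolding m_connected_map_def
proof (intro conjI allI impI)
  let ?Z = "power_space n X" and ?F = "configuration_space n X"
  show "x \<in> topspace ?F" "continuous_map ?F ?Z id" "id x = x"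
    using assms(4) continuous_map_configuration_space_id by auto
  show "homotopy_group_map j ?Z x id ` carrier (homotopy_group j ?F x) = carrier (homotopy_group j ?Z x)"
    if "int j = int d - 1" for j
    using surjective_on_homotopy_groups[OF assms(1) _ assms(4), of j] that by linarith
  show "if j = 0
        then bij_betw (homotopy_group_map j ?Z x id) (carrier (homotopy_group j ?F x)) (carrier (homotopy_group j ?Z x))
        else homotopy_group_map j ?Z x id \<in> iso (homotopy_group j ?F x) (homotopy_group j ?Z x)"
    if "int j \<le> int d - 1 - 1" for j
  proof -
    have j: "Suc j < d" "j < d" using that by linarith+
    have "bij_betw (homotopy_group_map j ?Z x id) (carrier (homotopy_group j ?F x)) (carrier (homotopy_group j ?Z x))"
      unfolding bij_betw_def
      using injective_on_homotopy_groups[OF assms(1) j(1) assms(4)]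
        surjective_on_homotopy_groups[OF assms(1) j(2) assms(4)] by simp
    moreover have "homotopy_group_map j ?Z x id \<in> hom (homotopy_group j ?F x) (homotopy_group j ?Z x)" if "j \<noteq> 0"
      using that by (intro homotopy_group_map_hom continuous_map_configuration_space_id) simp_all
    ultimately show ?thesis by (cases "j = 0") (simp_all add: iso_def)
  qed
qed

end
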